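(* For any equation $A=B$ between primitive recursive terms, $A=B$ is provable in $\mathsf{PRA}$ if and only if $A=B$ is provable in $\mathsf{CPRA}$; that is, $$\mathsf{PRA}\vdash A=B \iff \mathsf{CPRA}\vdash A=B.$$
   Context: **Language.** The sets $\mathsf{PR}^n$ of $n$-ary primitive recursive function symbols are inductively defined by: (1) $0\in\mathsf{PR}^0$, $o\in\mathsf{PR}^1$, $s\in\mathsf{PR}^1$, and $I^n_k\in\mathsf{PR}^n$ for $1\le k\le n$; (2) if $g\in\mathsf{PR}^m$ with $m>1$ and $f_1,\dots,f_m\in\mathsf{PR}^n$, then $C(g,f_1,\dots,f_m)\in\mathsf{PR}^n$; (3) if $g\in\mathsf{PR}^n$ and $h\in\mathsf{PR}^{n+2}$, then $R(g,h)\in\mathsf{PR}^{n+1}$. Primitive recursive terms are built from a countable set of variables $\{x_0,x_1,x_2,\dots\}$ by means of the function symbols in $\bigcup_n\mathsf{PR}^n$. Formulas of $\mathsf{PRA}$ and of $\mathsf{CPRA}$ are equations $A=B$ between such terms. $G(A)$ denotes the result of substituting the term $A$ for the variable $x$ in $G=G(x)$; terms may contain other variables as parameters. **The system $\mathsf{PRA}$.** Initial equations: $A=A$ for every term $A$. Inference rules (premises / conclusion): (a) Rules for function symbols, where $F$ contains a single occurrence of a fresh variable that is replaced by the indicated term, and $\vec B$ is a list of terms of appropriate length: - from $F(0)=A$ infer $F(o(B))=A$; - from $F(B_k)=A$ infer $F(I^n_k(B_1,\dots,B_n))=A$; - from $F(g(f_1(\vec B),\dots,f_m(\vec B)))=A$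 infer $F(C(g,f_1,\dots,f_m)(\vec B))=A$; - from $F(g(\vec B))=A$ infer $F(R(g,h)(\vec B,0))=A$; - from $F(h(\vec B,E,R(g,h)(\vec B,E)))=A$ infer $F(R(g,h)(\vec B,s(E)))=A$; - and, for each of these five rules, the rule obtained by exchanging the left-hand and right-hand sides of both premise and conclusion (for example, from $A=F(0)$ infer $A=F(o(B))$). (b) $(\mathsf{sub})$: from $G(x)=H(x)$ infer $G(A)=H(A)$. $(\mathsf{rep})$: from $A=B$ infer $G(A)=G(B)$. $(\mathsf{tran})$: from $A=B$ and $B=C$ infer $A=C$. (c) $(\mathsf{ind})$: from $G(0)=H(0)$, $G(s(x))=J(x,G(x))$ and $J(x,H(x))=H(s(x))$ infer $G(x)=H(x)$. A proof of $A=B$ in $\mathsf{PRA}$ is a finite tree of equations constructed according to these rules, with every leaf marked by an initial equation and the root marked by $A=B$. The equation $A=B$ is provable in $\mathsf{PRA}$ if it has such a proof. **The system $\mathsf{CPRA}$.** Its rules are those of $\mathsf{PRA}$ with $(\mathsf{ind})$ replaced by the rule $(\mathsf{case})$: from the left premise $G(0)=H(0)$ and the right premise $G(s(x))=H(s(x))$ infer $G(x)=H(x)$. The variable $x$ is called the active variable of the inference. A cyclic proof of $A=B$ is a pair $(\kappa,d)$, where $\kappa$ is a finite tree of equations constructed according to the rules of $\mathsf{CPRA}$ with root marked by $A=B$, and $d$ is a function such that: (i) $d$ is defined on the set of all leaves of $\kappa$ not marked by initial equations; (ii) for each such leaf $a$, the node $d(a)$ lies on the path from the root of $\kappa$ to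 $a$ and $d(a)\ne a$; (iii) there is an application of $(\mathsf{case})$ on the path from $d(a)$ to $a$, and this path intersects that application on the right premise; (iv) there are no applications of $(\mathsf{sub})$ on the path between $d(a)$ and $a$; (v) $a$ and $d(a)$ are marked by the same equation; (vi) the path from $d(a)$ to $a$ does not intersect any application of $(\mathsf{case})$ on the left premise; (vii) $d(a)$ is the conclusion of an application of $(\mathsf{case})$. An equation $A=B$ is provable in $\mathsf{CPRA}$ if there is a cyclic proof of $A=B$. *)

theory Defs
  imports Main "HOL-Library.Sublist"
begin

section \<open>Primitive recursive terms and equations\<close>

text \<open>
  The raw type of symbols carries no arities: \<open>PR n f\<close> below says that \<open>f\<close> is an \<open>n\<close>-ary symbol, and
  ill-formed raw terms are excluded by \<open>wf_trm\<close>.  Projections are indexed from 1.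
\<close>

datatype sym =
    ZeroSym
  | Null
  | Succ
  | Proj nat nat
  | Comp sym "sym list"
  | Rec sym sym

inductive PR :: "nat \<Rightarrow> sym \<Rightarrow> bool" where
  zero: "PR 0 ZeroSym"
| null: "PR 1 Null"
| succ: "PR 1 Succ"
| proj: "1 \<le> k \<Longrightarrow> k \<le> n \<Longrightarrow> PR n (Proj n k)"
| comp: "PR m g \<Longrightarrow> m > 1 \<Longrightarrow> length fs = m \<Longrightarrow> (\<And>f. f \<in> set fs \<Longrightarrow> PR n f) \<Longrightarrow> PR n (Comp g fs)"
| rec: "PR n g \<Longrightarrow> PR (n + 2) h \<Longrightarrow> PR (n + 1) (Rec g h)"

datatype trm = Var nat | App sym "trm list"

fun wf_trm :: "trm \<Rightarrow> bool" where
  "wf_trm (Var x) \<longleftrightarrow> True"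
| "wf_trm (App f ts) \<longleftrightarrow> PR (length ts) f \<and> (\<forall>t \<in> set ts. wf_trm t)"

abbreviation zero :: trm where
  "zero \<equiv> App ZeroSym []"

abbreviation succ :: "trm \<Rightarrow> trm" where
  "succ A \<equiv> App Succ [A]"

text \<open>\<open>subst x A G\<close> is the term \<open>G(A)\<close>, where \<open>G = G(x)\<close>.\<close>

primrec subst :: "nat \<Rightarrow> trm \<Rightarrow> trm \<Rightarrow> trm" where
  "subst x A (Var y) = (if y = x then A else Var y)"
| "subst x A (App f ts) = App f (map (subst x A) ts)"

text \<open>Number of occurrences of a variable in a term.\<close>

primrec occ :: "nat \<Rightarrow> trm \<Rightarrow> nat" where
  "occ x (Var y) = (if y = x then 1 else 0)"
| "occ x (App f ts) = sum_list (map (occ x) ts)"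

datatype eqn = Eq (lhs: trm) (rhs: trm) (infix "\<approx>" 50)

definition wf_eqn :: "eqn \<Rightarrow> bool" where
  "wf_eqn e \<longleftrightarrow> wf_trm (lhs e) \<and> wf_trm (rhs e)"

definition initial :: "eqn \<Rightarrow> bool" where
  "initial e \<longleftrightarrow> (\<exists>A. e = (A \<approx> A))"


section \<open>Inference rules\<close>

text \<open>
  \<open>unfolds P Q\<close> pairs the term \<open>P\<close> displayed in the conclusion of one of the five rules for
  function symbols with the term \<open>Q\<close> displayed in its premise.
\<close>

inductive unfolds :: "trm \<Rightarrow> trm \<Rightarrow> bool" where
  "unfolds (App Null [B]) zero"
| "1 \<le> k \<Longrightarrow> k \<le> n \<Longrightarrow> length Bs = n \<Longrightarrow> unfolds (App (Proj n k) Bs) (Bs ! (k - 1))"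
| "unfolds (App (Comp g fs) Bs) (App g (map (\<lambda>f. App f Bs) fs))"
| "unfolds (App (Rec g h) (Bs @ [zero])) (App g Bs)"
| "unfolds (App (Rec g h) (Bs @ [succ E])) (App h (Bs @ [E, App (Rec g h) (Bs @ [E])]))"

datatype rule_name = Fun | Sub | Rep | Tran | Ind | Case

text \<open>
  \<open>infer r es e\<close>: the equation \<open>e\<close> follows from the list of premises \<open>es\<close> by the rule \<open>r\<close>.
  Well-formedness is not imposed here but at every node of a derivation tree.
\<close>

inductive infer :: "rule_name \<Rightarrow> eqn list \<Rightarrow> eqn \<Rightarrow> bool" where
  fun_left:
    "unfolds P Q \<Longrightarrow> occ x F = 1 \<Longrightarrow> occ x P = 0 \<Longrightarrow> occ x Q = 0 \<Longrightarrow> occ x A = 0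
       \<Longrightarrow> infer Fun [subst x Q F \<approx> A] (subst x P F \<approx> A)"
| fun_right:
    "unfolds P Q \<Longrightarrow> occ x F = 1 \<Longrightarrow> occ x P = 0 \<Longrightarrow> occ x Q = 0 \<Longrightarrow> occ x A = 0
       \<Longrightarrow> infer Fun [A \<approx> subst x Q F] (A \<approx> subst x P F)"
| sub:
    "infer Sub [G \<approx> H] (subst x A G \<approx> subst x A H)"
| rep:
    "infer Rep [A \<approx> B] (subst x A G \<approx> subst x B G)"
| tran:
    "infer Tran [A \<approx> B, B \<approx> C] (A \<approx> C)"
| ind:
    \<comment> \<open>\<open>J = J(x, y)\<close>; only \<open>y\<close> is replaced, so \<open>subst y G J\<close> is \<open>J(x, G(x))\<close>\<close>
    "x \<noteq> y \<Longrightarrow>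
       infer Ind [subst x zero G \<approx> subst x zero H,
                  subst x (succ (Var x)) G \<approx> subst y G J,
                  subst y H J \<approx> subst x (succ (Var x)) H] (G \<approx> H)"
| case_rule:
    "infer Case [subst x zero G \<approx> subst x zero H,
                 subst x (succ (Var x)) G \<approx> subst x (succ (Var x)) H] (G \<approx> H)"


section \<open>Derivation trees\<close>

text \<open>
  Inner nodes record the name of the applied rule, because the same step between equations may be
  an instance of several rules and the conditions on cyclic proofs refer to the rule applied.
\<close>

datatype dtree =
    Leaf (concl: eqn)
  | Step rule_name (concl: eqn) "dtree list"

fun constructed_by :: "rule_name set \<Rightarrow> dtree \<Rightarrow> bool" where
  "constructed_by R (Leaf e) \<longleftrightarrow> wf_eqn e"
| "constructed_by R (Step r e ts) \<longleftrightarrow>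
     wf_eqn e \<and> r \<in> R \<and> infer r (map concl ts) e \<and> (\<forall>t \<in> set ts. constructed_by R t)"

text \<open>
  Nodes are addressed by positions: \<open>[]\<close> is the root and \<open>p @ [i]\<close> is the \<open>i\<close>-th premise, counted
  from 0, of the inference at \<open>p\<close>.  The nodes on the path from the root to \<open>a\<close> are thus the
  prefixes of \<open>a\<close>.
\<close>

type_synonym pos = "nat list"

fun at :: "dtree \<Rightarrow> pos \<Rightarrow> dtree option" where
  "at t [] = Some t"
| "at (Leaf e) (i # p) = None"
| "at (Step r e ts) (i # p) = (if i < length ts then at (ts ! i) p else None)"

definition leaf_at :: "dtree \<Rightarrow> pos \<Rightarrow> eqn \<Rightarrow> bool" where
  "leaf_at t a e \<longleftrightarrow> at t a = Some (Leaf e)"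

definition applied_at :: "dtree \<Rightarrow> pos \<Rightarrow> rule_name \<Rightarrow> bool" where
  "applied_at t p r \<longleftrightarrow> (\<exists>e ts. at t p = Some (Step r e ts))"


section \<open>Provability\<close>

definition pra_proof :: "dtree \<Rightarrow> eqn \<Rightarrow> bool" where
  "pra_proof t e \<longleftrightarrow>
     constructed_by {Fun, Sub, Rep, Tran, Ind} t \<and> concl t = e \<and>
     (\<forall>a e'. leaf_at t a e' \<longrightarrow> initial e')"

definition pra_provable :: "eqn \<Rightarrow> bool" where
  "pra_provable e \<longleftrightarrow> (\<exists>t. pra_proof t e)"

text \<open>
  An application of a rule at \<open>p\<close> lies on the path from \<open>c\<close> to \<open>a\<close> if both its conclusion \<open>p\<close> and
  one of its premises \<open>p @ [i]\<close> do; for the case rule, \<open>i = 0\<close> is the left and \<open>i = 1\<close> the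
  right premise.
\<close>

definition path_through :: "dtree \<Rightarrow> pos \<Rightarrow> pos \<Rightarrow> rule_name \<Rightarrow> nat \<Rightarrow> bool" where
  "path_through t c a r i \<longleftrightarrow> (\<exists>p. applied_at t p r \<and> prefix c p \<and> prefix (p @ [i]) a)"

definition cyclic_proof :: "dtree \<Rightarrow> (pos \<rightharpoonup> pos) \<Rightarrow> eqn \<Rightarrow> bool" where
  "cyclic_proof t d e \<longleftrightarrow>
     constructed_by {Fun, Sub, Rep, Tran, Case} t \<and> concl t = e \<and>
     dom d = {a. \<exists>e'. leaf_at t a e' \<and> \<not> initial e'} \<and>
     (\<forall>a c. d a = Some c \<longrightarrow>
        prefix c a \<and> c \<noteq> a \<and>
        path_through t c a Case 1 \<and>
        (\<forall>i. \<not> path_through t c a Sub i) \<and>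
        map_option concl (at t a) = map_option concl (at t c) \<and>
        \<not> path_through t c a Case 0 \<and>
        applied_at t c Case)"

definition cpra_provable :: "eqn \<Rightarrow> bool" where
  "cpra_provable e \<longleftrightarrow> (\<exists>t d. cyclic_proof t d e)"

end

theory Submission
  imports Defs
begin

text \<open>
  From \<open>PRA\<close> to \<open>CPRA\<close>, an application of \<open>(ind)\<close> with conclusion \<open>G(x) = H(x)\<close> becomes an application
  of \<open>(case)\<close> whose right premise is obtained along \<open>G(s x) = J(x, G(x)) = J(x, H(x)) = H(s x)\<close>; the
  middle equation follows by \<open>(rep)\<close> from \<open>G(x) = H(x)\<close>, which is a leaf linked back to the conclusion
  (\<open>cyc_ind\<close>).

  From \<open>CPRA\<close> to \<open>PRA\<close>, read a cyclic proof as a derivation of its equations from hypotheses: on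
  passing from the conclusion of \<open>(case)\<close> to its right premise, the active variable drops by one and
  the conclusion becomes a hypothesis, available for smaller values of the variables. Since
  \<open>(sub)\<close> and left premises of \<open>(case)\<close> are never crossed between a target and its leaf, variables
  can only decrease on the way. So the invariant of an induction on the proof (\<open>cyc_sound\<close>) is: whenever
  a condition \<open>C\<close> on the variables is inherited by smaller values (\<open>down_closed\<close>) and implies all
  current hypotheses, it implies the equation. At an application of \<open>(case)\<close> with conclusion \<open>E\<close> and
  active variable \<open>x\<close>, this is used for \<open>C\<close> together with ``\<open>E\<close> holds for all values up to
  the present ones'', and that bounded statement is proved by induction on \<open>x\<close> (\<open>case_sound\<close>).

  It remains to express conditions, implications and bounded quantifiers inside an equational theory.
  A condition is an equation \<open>c = 0\<close>. With a definition by cases \<open>cnd c a b\<close>, which is \<open>a\<close> for \<open>c = 0\<close> and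
  \<open>b\<close> for positive \<open>c\<close>, the equation \<open>cnd c a b = b\<close> says that \<open>c = 0\<close> implies \<open>a = b\<close>; this is \<open>imp c a b\<close>.
  Equality is decided by a term \<open>dist a b\<close> that vanishes on equal arguments and satisfies
  \<open>imp (dist a b) a b\<close>. A bounded quantifier is defined by primitive recursion on its bound, for which
  every term is first turned into a function symbol (\<open>symbol_of_term\<close>).

  All this takes place in the Lindenbaum algebra of \<open>PRA\<close>, the algebra of well-formed terms modulo
  provable equality, where provable equations are equations proper. The rule \<open>(ind)\<close> becomes the statement
  that functions on this algebra which are given by terms with parameters are determined by
  recursion equations (\<open>recursion_unique\<close>).
\<close>

section \<open>Derivability without positions\<close>

lemma leaf_at_Leaf: "leaf_at (Leaf e) a e' \<longleftrightarrow> a = [] \<and> e' = e"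
  by (cases a) (auto simp: leaf_at_def)

lemma leaf_at_Step:
  "leaf_at (Step r e ts) a e' \<longleftrightarrow> (\<exists>i p. a = i # p \<and> i < length ts \<and> leaf_at (ts ! i) p e')"
  by (cases a) (auto simp: leaf_at_def)

inductive pra :: "eqn \<Rightarrow> bool" where
  pra_init: "wf_eqn e \<Longrightarrow> initial e \<Longrightarrow> pra e"
| pra_step: "wf_eqn e \<Longrightarrow> r \<in> {Fun, Sub, Rep, Tran, Ind} \<Longrightarrow> infer r es e
    \<Longrightarrow> (\<And>e'. e' \<in> set es \<Longrightarrow> pra e') \<Longrightarrow> pra e"

lemma pra_provable_iff: "pra_provable e \<longleftrightarrow> pra e"
proof
  have "constructed_by {Fun, Sub, Rep, Tran, Ind} t
      \<Longrightarrow> \<forall>a e'. leaf_at t a e' \<longrightarrow> initial e' \<Longrightarrow> pra (concl t)" for t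
  proof (induction t)
    case (Leaf e)
    then show ?case by (auto simp: leaf_at_Leaf intro: pra_init)
  next
    case (Step r e ts)
    have *: "pra (concl t)" if t: "t \<in> set ts" for t
    proof (rule Step.IH[OF t])
      obtain i where "i < length ts" "ts ! i = t" using t by (auto simp: in_set_conv_nth)
      then show "\<forall>a e'. leaf_at t a e' \<longrightarrow> initial e'" using Step.prems(2)
        by (metis leaf_at_Step)
    qed (use Step.prems t in simp)
    have "pra e"
      by (rule pra_step[of e r "map concl ts"]) (use Step.prems(1) * in auto)
    then show ?case by simp
  qed
  then show "pra_provable e \<Longrightarrow> pra e" by (auto simp: pra_provable_def pra_proof_def)
next
  show "pra e \<Longrightarrow> pra_provable e"
  proof (induction rule: pra.induct)
    case (pra_init e)
    then have "pra_proof (Leaf e) e" by (simp add: pra_proof_def leaf_at_Leaf)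
    then show ?case by (auto simp: pra_provable_def)
  next
    case (pra_step e r es)
    then obtain f where f: "\<And>e'. e' \<in> set es \<Longrightarrow> pra_proof (f e') e'"
      unfolding pra_provable_def by metis
    then have "map concl (map f es) = es" by (auto simp: pra_proof_def intro!: map_idI)
    then have "pra_proof (Step r e (map f es)) e" using pra_step.hyps f
      unfolding pra_proof_def leaf_at_Step
      by (auto simp del: map_map) (metis nth_mem)+
    then show ?case by (auto simp: pra_provable_def)
  qed
qed

text \<open>
  The conclusions of \<open>(case)\<close> to which leaves above a premise may be linked, in terms of those available
  at the conclusion. No link may cross \<open>(sub)\<close> or a left premise of \<open>(case)\<close>, and every target is the
  conclusion of a \<open>(case)\<close>.
\<close>
definition inherit :: "rule_name \<Rightarrow> nat \<Rightarrow> eqn \<Rightarrow> eqn set \<Rightarrow> eqn set" where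
  "inherit r i e \<Gamma> =
     (if r = Sub \<or> r = Case \<and> i = 0 then {} else if r = Case then insert e \<Gamma> else \<Gamma>)"

text \<open>
  \<open>cyc \<Gamma> e\<close> means that \<open>e\<close> has a cyclic derivation in which leaves may also be closed by the equations in \<open>\<Gamma>\<close>,
  the possible targets below it. The path from a target to a leaf is bound to cross a right premise,
  since it starts at the conclusion of a \<open>(case)\<close> and avoids the left premise.
\<close>
inductive cyc :: "eqn set \<Rightarrow> eqn \<Rightarrow> bool" where
  cyc_init: "wf_eqn e \<Longrightarrow> initial e \<Longrightarrow> cyc \<Gamma> e"
| cyc_back: "wf_eqn e \<Longrightarrow> e \<in> \<Gamma> \<Longrightarrow> cyc \<Gamma> e"
| cyc_step: "wf_eqn e \<Longrightarrow> r \<in> {Fun, Sub, Rep, Tran, Case} \<Longrightarrow> infer r es e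
    \<Longrightarrow> (\<And>i. i < length es \<Longrightarrow> cyc (inherit r i e \<Gamma>) (es ! i)) \<Longrightarrow> cyc \<Gamma> e"

definition backlink :: "dtree \<Rightarrow> pos \<Rightarrow> pos \<Rightarrow> bool" where
  "backlink t a c \<longleftrightarrow> prefix c a \<and> c \<noteq> a \<and> path_through t c a Case 1 \<and>
     (\<forall>i. \<not> path_through t c a Sub i) \<and>
     map_option concl (at t a) = map_option concl (at t c) \<and>
     \<not> path_through t c a Case 0 \<and> applied_at t c Case"

definition uninterrupted :: "dtree \<Rightarrow> pos \<Rightarrow> bool" where
  "uninterrupted t a \<longleftrightarrow> (\<forall>i. \<not> path_through t [] a Sub i) \<and> \<not> path_through t [] a Case 0"

text \<open>
  A subtree of a cyclic proof in which links leaving the subtree are recorded only by the equation they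
  lead to; the empty \<open>\<Gamma>\<close> gives the condition on a complete cyclic proof.
\<close>
definition grounded :: "eqn set \<Rightarrow> dtree \<Rightarrow> bool" where
  "grounded \<Gamma> t \<longleftrightarrow> (\<forall>a e. leaf_at t a e \<longrightarrow> initial e \<or> (\<exists>c. backlink t a c) \<or>
     e \<in> \<Gamma> \<and> uninterrupted t a)"

text \<open>
  The function \<open>d\<close> chooses a target for each leaf independently, so it can be traded for the existence
  of targets.
\<close>
lemma cyclic_proof_iff:
  "(\<exists>d. cyclic_proof t d e) \<longleftrightarrow>
     constructed_by {Fun, Sub, Rep, Tran, Case} t \<and> concl t = e \<and> grounded {} t"
proof
  assume "\<exists>d. cyclic_proof t d e"
  then obtain d where d: "cyclic_proof t d e" ..
  have "\<exists>c. backlink t a c" if "leaf_at t a e'" "\<not> initial e'" for a e'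
  proof -
    have "a \<in> dom d" using d that by (auto simp: cyclic_proof_def)
    then obtain c where "d a = Some c" by blast
    then have "backlink t a c" using d by (simp add: cyclic_proof_def backlink_def)
    then show ?thesis ..
  qed
  then show "constructed_by {Fun, Sub, Rep, Tran, Case} t \<and> concl t = e \<and> grounded {} t"
    using d by (auto simp: grounded_def cyclic_proof_def)
next
  assume *: "constructed_by {Fun, Sub, Rep, Tran, Case} t \<and> concl t = e \<and> grounded {} t"
  define d where "d a = (if \<exists>e'. leaf_at t a e' \<and> \<not> initial e'
    then Some (SOME c. backlink t a c) else None)" for a
  have "backlink t a c" if "d a = Some c" for a c
  proof -
    have "\<exists>c. backlink t a c" "c = (SOME c. backlink t a c)"
      using that * by (auto simp: d_def grounded_def split: if_splits)
    then show ?thesis by (simp add: someI_ex)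
  qed
  moreover have "dom d = {a. \<exists>e'. leaf_at t a e' \<and> \<not> initial e'}"
    by (auto simp: d_def split: if_splits)
  ultimately have "cyclic_proof t d e" using *
    unfolding cyclic_proof_def backlink_def by blast
  then show "\<exists>d. cyclic_proof t d e" by blast
qed

lemma applied_at_simps:
  "applied_at (Step r e ts) [] r' \<longleftrightarrow> r' = r"
  "applied_at (Step r e ts) (i # p) r' \<longleftrightarrow> i < length ts \<and> applied_at (ts ! i) p r'"
  by (auto simp: applied_at_def)

lemma path_through_Cons:
  "path_through (Step r e ts) (i # c) (j # a) r' k \<longleftrightarrow>
     i = j \<and> i < length ts \<and> path_through (ts ! i) c a r' k"
proof
  assume "path_through (Step r e ts) (i # c) (j # a) r' k"
  then obtain p where p: "applied_at (Step r e ts) p r'" "prefix (i # c) p" "prefix (p @ [k]) (j # a)"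
    by (auto simp: path_through_def)
  then obtain q where "p = i # q" by (cases p) auto
  with p show "i = j \<and> i < length ts \<and> path_through (ts ! i) c a r' k"
    by (auto simp: path_through_def applied_at_simps)
next
  assume "i = j \<and> i < length ts \<and> path_through (ts ! i) c a r' k"
  then obtain q where "i = j" "i < length ts" "applied_at (ts ! i) q r'" "prefix c q" "prefix (q @ [k]) a"
    by (auto simp: path_through_def)
  then show "path_through (Step r e ts) (i # c) (j # a) r' k"
    unfolding path_through_def by (intro exI[of _ "i # q"]) (auto simp: applied_at_simps)
qed

lemma path_through_Nil:
  "path_through (Step r e ts) [] (j # a) r' k \<longleftrightarrow>
     r' = r \<and> k = j \<or> j < length ts \<and> path_through (ts ! j) [] a r' k"
proof
  assume "path_through (Step r e ts) [] (j # a) r' k"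
  then obtain p where p: "applied_at (Step r e ts) p r'" "prefix (p @ [k]) (j # a)"
    by (auto simp: path_through_def)
  then show "r' = r \<and> k = j \<or> j < length ts \<and> path_through (ts ! j) [] a r' k"
    by (cases p) (auto simp: path_through_def applied_at_simps)
next
  assume "r' = r \<and> k = j \<or> j < length ts \<and> path_through (ts ! j) [] a r' k"
  then consider "r' = r" "k = j" | q where "j < length ts" "applied_at (ts ! j) q r'" "prefix (q @ [k]) a"
    by (auto simp: path_through_def)
  then show "path_through (Step r e ts) [] (j # a) r' k"
  proof cases
    case 1
    then show ?thesis
      unfolding path_through_def by (intro exI[of _ "[]"]) (auto simp: applied_at_simps)
  next
    case 2
    then show ?thesis
      unfolding path_through_def by (intro exI[of _ "j # q"]) (auto simp: applied_at_simps)
  qed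
qed

lemma backlink_Cons:
  "j < length ts \<Longrightarrow> backlink (Step r e ts) (j # a) (i # c) \<longleftrightarrow> i = j \<and> backlink (ts ! j) a c"
  by (auto simp: backlink_def path_through_Cons applied_at_simps)

lemma uninterrupted_Cons:
  "j < length ts \<Longrightarrow> uninterrupted (Step r e ts) (j # a) \<longleftrightarrow>
     r \<noteq> Sub \<and> \<not> (r = Case \<and> j = 0) \<and> uninterrupted (ts ! j) a"
  by (auto simp: uninterrupted_def path_through_Nil)

lemma infer_Case_length: "infer Case es e \<Longrightarrow> length es = 2"
  by (erule infer.cases) auto

lemma backlink_Nil:
  assumes "j < length ts" "infer r (map concl ts) e" "leaf_at (ts ! j) a e'"
  shows "backlink (Step r e ts) (j # a) [] \<longleftrightarrow>
     r = Case \<and> j = 1 \<and> uninterrupted (ts ! j) a \<and> e' = e"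
proof -
  have "r = Case \<Longrightarrow> j = 0 \<or> j = 1" using assms infer_Case_length by fastforce
  then show ?thesis using assms(1,3)
    by (auto simp: backlink_def uninterrupted_def path_through_Nil applied_at_simps leaf_at_def)
qed

lemma grounded_Leaf: "grounded \<Gamma> (Leaf e) \<longleftrightarrow> initial e \<or> e \<in> \<Gamma>"
proof -
  have "\<not> backlink (Leaf e) [] c" for c by (auto simp: backlink_def)
  moreover have "\<not> path_through (Leaf e) [] [] r i" for r i by (auto simp: path_through_def)
  ultimately show ?thesis by (auto simp: grounded_def leaf_at_Leaf uninterrupted_def)
qed

text \<open>
  A link either stays within the subtree above one premise, or starts at the root, or passes through the
  root. Only the last two kinds concern hypotheses, and \<open>inherit\<close> is made to describe them.
\<close>
lemma grounded_Step:
  assumes "infer r (map concl ts) e"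
  shows "grounded \<Gamma> (Step r e ts) \<longleftrightarrow> (\<forall>j<length ts. grounded (inherit r j e \<Gamma>) (ts ! j))"
proof -
  have "(\<exists>c. backlink (Step r e ts) (j # a) c) \<or> e' \<in> \<Gamma> \<and> uninterrupted (Step r e ts) (j # a)
    \<longleftrightarrow> (\<exists>c. backlink (ts ! j) a c) \<or> e' \<in> inherit r j e \<Gamma> \<and> uninterrupted (ts ! j) a"
    if j: "j < length ts" and l: "leaf_at (ts ! j) a e'" for j a e'
  proof -
    have "r = Case \<Longrightarrow> j = 0 \<or> j = 1" using assms j infer_Case_length by fastforce
    moreover have "(\<exists>c. backlink (Step r e ts) (j # a) c) \<longleftrightarrow>
        backlink (Step r e ts) (j # a) [] \<or> (\<exists>i c. backlink (Step r e ts) (j # a) (i # c))"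
      by (metis neq_Nil_conv)
    ultimately show ?thesis
      by (auto simp: backlink_Cons[OF j] backlink_Nil[OF j assms l] uninterrupted_Cons[OF j] inherit_def)
  qed
  then show ?thesis unfolding grounded_def leaf_at_Step by blast
qed

lemma cyc_iff:
  "cyc \<Gamma> e \<longleftrightarrow>
     (\<exists>t. constructed_by {Fun, Sub, Rep, Tran, Case} t \<and> concl t = e \<and> grounded \<Gamma> t)"
proof
  show "cyc \<Gamma> e \<Longrightarrow>
     \<exists>t. constructed_by {Fun, Sub, Rep, Tran, Case} t \<and> concl t = e \<and> grounded \<Gamma> t"
  proof (induction rule: cyc.induct)
    case (cyc_init e \<Gamma>)
    then show ?case by (intro exI[of _ "Leaf e"]) (simp add: grounded_Leaf)
  next
    case (cyc_back e \<Gamma>)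
    then show ?case by (intro exI[of _ "Leaf e"]) (simp add: grounded_Leaf)
  next
    case (cyc_step e r es \<Gamma>)
    then obtain f where f: "constructed_by {Fun, Sub, Rep, Tran, Case} (f i)" "concl (f i) = es ! i"
      "grounded (inherit r i e \<Gamma>) (f i)" if "i < length es" for i by metis
    let ?ts = "map f [0..<length es]"
    have ts: "map concl ?ts = es" using f by (auto intro!: nth_equalityI)
    then have "grounded \<Gamma> (Step r e ?ts)" using cyc_step.hyps f
      by (subst grounded_Step) (auto simp del: map_map)
    moreover have "constructed_by {Fun, Sub, Rep, Tran, Case} (Step r e ?ts)"
      using cyc_step.hyps f ts by (auto simp del: map_map)
    ultimately show ?case by (intro exI[of _ "Step r e ?ts"]) simp
  qed
next
  have "constructed_by {Fun, Sub, Rep, Tran, Case} t \<Longrightarrow> grounded \<Gamma> t \<Longrightarrow> cyc \<Gamma> (concl t)" for t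
  proof (induction t arbitrary: \<Gamma>)
    case (Leaf e)
    then show ?case by (auto simp: grounded_Leaf intro: cyc.intros)
  next
    case (Step r e ts)
    then have inf: "infer r (map concl ts) e" by simp
    have "cyc \<Gamma> e"
      by (rule cyc_step[OF _ _ inf]) (use Step grounded_Step[OF inf] in auto)
    then show ?case by simp
  qed
  then show "\<exists>t. constructed_by {Fun, Sub, Rep, Tran, Case} t \<and> concl t = e \<and> grounded \<Gamma> t
      \<Longrightarrow> cyc \<Gamma> e" by blast
qed

lemma cpra_provable_iff: "cpra_provable e \<longleftrightarrow> cyc {} e"
  by (simp add: cpra_provable_def cyclic_proof_iff cyc_iff)

section \<open>Cyclic simulation of induction\<close>

lemma cyc_mono: "cyc \<Gamma> e \<Longrightarrow> \<Gamma> \<subseteq> \<Delta> \<Longrightarrow> cyc \<Delta> e"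
proof (induction arbitrary: \<Delta> rule: cyc.induct)
  case (cyc_step e r es \<Gamma>)
  have "inherit r i e \<Gamma> \<subseteq> inherit r i e \<Delta>" for i using cyc_step.prems by (auto simp: inherit_def)
  then show ?case using cyc_step by (intro cyc.cyc_step[of e r es]) auto
qed (auto intro: cyc.intros)

lemma cyc_wf: "cyc \<Gamma> e \<Longrightarrow> wf_eqn e"
  by (induction rule: cyc.induct)

lemma cyc_tran:
  assumes "cyc \<Gamma> (A \<approx> B)" "cyc \<Gamma> (B \<approx> C)"
  shows "cyc \<Gamma> (A \<approx> C)"
  by (rule cyc_step[OF _ _ infer.tran[of A B C]])
    (use assms assms[THEN cyc_wf] in \<open>auto simp: less_Suc_eq inherit_def wf_eqn_def\<close>)

text \<open>
  The premises of \<open>(ind)\<close> occur in the simulation with no hypotheses at all, the induction hypothesis being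
  the single back link.
\<close>
lemma cyc_ind:
  assumes "x \<noteq> y" "wf_eqn (G \<approx> H)"
    and "cyc {} (subst x zero G \<approx> subst x zero H)"
    and "cyc {} (subst x (succ (Var x)) G \<approx> subst y G J)"
    and "cyc {} (subst y H J \<approx> subst x (succ (Var x)) H)"
  shows "cyc \<Gamma> (G \<approx> H)"
proof (rule cyc_step[OF _ _ infer.case_rule[of x G H]])
  let ?\<Delta> = "insert (G \<approx> H) \<Gamma>"
  have "cyc ?\<Delta> (subst y G J \<approx> subst y H J)"
    by (rule cyc_step[OF _ _ infer.rep[of G H]])
      (use assms assms(4,5)[THEN cyc_wf] in \<open>auto simp: less_Suc_eq inherit_def wf_eqn_def intro: cyc_back\<close>)
  then have "cyc ?\<Delta> (subst x (succ (Var x)) G \<approx> subst x (succ (Var x)) H)"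
    by (meson assms(4,5) cyc_mono cyc_tran empty_subsetI)
  then show "cyc (inherit Case i (G \<approx> H) \<Gamma>)
      ([subst x zero G \<approx> subst x zero H,
        subst x (succ (Var x)) G \<approx> subst x (succ (Var x)) H] ! i)"
    if "i < length [subst x zero G \<approx> subst x zero H,
        subst x (succ (Var x)) G \<approx> subst x (succ (Var x)) H]" for i
    using that assms(3) by (auto simp: less_Suc_eq inherit_def)
qed (use assms in auto)

lemma pra_imp_cyc: "pra e \<Longrightarrow> cyc {} e"
proof (induction rule: pra.induct)
  case (pra_init e)
  then show ?case by (rule cyc_init)
next
  case (pra_step e r es)
  show ?case
  proof (cases "r = Ind")
    case True
    with pra_step.hyps(3) show ?thesis
      by (cases rule: infer.cases) (use pra_step in \<open>auto intro: cyc_ind\<close>)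
  next
    case False
    then show ?thesis
      using pra_step by (intro cyc_step[of e r es]) (auto simp: inherit_def)
  qed
qed

section \<open>Derived rules for provable equality\<close>

lemma pra_wf: "pra e \<Longrightarrow> wf_eqn e"
  by (induction rule: pra.induct)

lemma pra_wfD: "pra (A \<approx> B) \<Longrightarrow> wf_trm A" "pra (A \<approx> B) \<Longrightarrow> wf_trm B"
  using pra_wf by (fastforce simp: wf_eqn_def)+

lemma pra_refl: "wf_trm A \<Longrightarrow> pra (A \<approx> A)"
  by (rule pra_init) (auto simp: wf_eqn_def initial_def)

text \<open>
  There is no rule of symmetry, but each rule has a mirror image: the two sets of rules for function
  symbols are exchanged, the premises of \<open>(tran)\<close> are exchanged, and so are the second and third premise
  of \<open>(ind)\<close>.
\<close>
lemma pra_sym: "pra (A \<approx> B) \<Longrightarrow> pra (B \<approx> A)"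
proof -
  have "pra e \<Longrightarrow> pra (rhs e \<approx> lhs e)" for e
  proof (induction rule: pra.induct)
    case (pra_init e)
    then show ?case by (intro pra.pra_init) (auto simp: wf_eqn_def initial_def)
  next
    case (pra_step e r es)
    have wf: "wf_eqn (rhs e \<approx> lhs e)" using pra_step.hyps(1) by (simp add: wf_eqn_def)
    from pra_step.hyps(3) show ?case
    proof (cases rule: infer.cases)
      case (fun_left P Q x F A)
      with wf pra_step.IH show ?thesis
        by simp (rule pra.pra_step[OF _ _ infer.fun_right[of P Q x F A]]; auto)
    next
      case (fun_right P Q x F A)
      with wf pra_step.IH show ?thesis
        by simp (rule pra.pra_step[OF _ _ infer.fun_left[of P Q x F A]]; auto)
    next
      case (sub G H x A)
      with wf pra_step.IH show ?thesis
        by simp (rule pra.pra_step[OF _ _ infer.sub[of H G x A]]; auto)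
    next
      case (rep A B x G)
      with wf pra_step.IH show ?thesis
        by simp (rule pra.pra_step[OF _ _ infer.rep[of B A x G]]; auto)
    next
      case (tran A B C)
      have "pra (B \<approx> A)" "pra (C \<approx> B)"
        using pra_step.IH[of "A \<approx> B"] pra_step.IH[of "B \<approx> C"] tran by simp_all
      then show ?thesis using wf tran
        by simp (rule pra.pra_step[OF _ _ infer.tran[of C B A]]; auto)
    next
      case (ind x y G H J)
      have prems: "pra (subst x zero H \<approx> subst x zero G)"
        "pra (subst x (succ (Var x)) H \<approx> subst y H J)"
        "pra (subst y G J \<approx> subst x (succ (Var x)) G)"
        using pra_step.IH ind(2) by fastforce+
      have "pra (H \<approx> G)"
        by (rule pra.pra_step[OF _ _ infer.ind[of x y H G J]])
          (use prems wf ind(3,4) in \<open>auto simp del: subst.simps\<close>)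
      then show ?thesis using ind(3) by simp
    next
      case case_rule
      then show ?thesis using pra_step.hyps(2) by simp
    qed
  qed
  from this[of "A \<approx> B"] show "pra (A \<approx> B) \<Longrightarrow> pra (B \<approx> A)" by simp
qed

lemma pra_tran: "pra (A \<approx> B) \<Longrightarrow> pra (B \<approx> C) \<Longrightarrow> pra (A \<approx> C)"
  by (rule pra_step[OF _ _ infer.tran[of A B C]]) (auto simp: wf_eqn_def dest: pra_wfD)

lemma wf_subst: "wf_trm A \<Longrightarrow> wf_trm t \<Longrightarrow> wf_trm (subst x A t)"
  by (induction t) auto

lemma wf_subst_imp_wf: "wf_trm (subst x A t) \<Longrightarrow> wf_trm t"
  by (induction t) auto

lemma pra_subst: "pra (G \<approx> H) \<Longrightarrow> wf_trm A \<Longrightarrow> pra (subst x A G \<approx> subst x A H)"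
  by (rule pra_step[OF _ _ infer.sub[of G H]]) (auto simp: wf_eqn_def dest: pra_wfD intro: wf_subst)

lemma pra_replace: "pra (A \<approx> B) \<Longrightarrow> wf_trm G \<Longrightarrow> pra (subst x A G \<approx> subst x B G)"
  by (rule pra_step[OF _ _ infer.rep[of A B]]) (auto simp: wf_eqn_def dest: pra_wfD intro: wf_subst)

primrec vars :: "trm \<Rightarrow> nat set" where
  "vars (Var x) = {x}"
| "vars (App f ts) = \<Union> (set (map vars ts))"

lemma finite_vars: "finite (vars t)"
  by (induction t) auto

lemma occ_eq_0_iff: "occ x t = 0 \<longleftrightarrow> x \<notin> vars t"
  by (induction t) auto

lemma subst_fresh: "x \<notin> vars t \<Longrightarrow> subst x A t = t"
  by (induction t) (auto intro: map_idI)

lemma fresh_var: "finite X \<Longrightarrow> \<exists>x::nat. x \<notin> X"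
  by (simp add: ex_new_if_finite)

lemma pra_unfold:
  assumes "unfolds P Q" "wf_trm P" "wf_trm Q"
  shows "pra (P \<approx> Q)"
proof -
  obtain x where x: "x \<notin> vars P \<union> vars Q"
    using fresh_var finite_vars by (metis finite_Un)
  then have "infer Fun [subst x Q (Var x) \<approx> Q] (subst x P (Var x) \<approx> Q)"
    using assms(1) by (intro infer.fun_left) (simp_all add: occ_eq_0_iff del: subst.simps)
  then show ?thesis
    using assms by (intro pra_step[of "P \<approx> Q" Fun "[Q \<approx> Q]"]) (auto simp: wf_eqn_def intro: pra_refl)
qed

text \<open>
  Rule \<open>(rep)\<close> replaces one argument at a time, in a term with a fresh variable at that position; \<open>ps\<close>
  collects the arguments already replaced.
\<close>
lemma pra_App_cong:
  assumes "list_all2 (\<lambda>t u. pra (t \<approx> u)) ts us" "PR (length ts) f"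
  shows "pra (App f ts \<approx> App f us)"
proof -
  have "\<forall>t \<in> set ps. wf_trm t \<Longrightarrow> PR (length ps + length ts) f
    \<Longrightarrow> pra (App f (ps @ ts) \<approx> App f (ps @ us))" for ps
    using assms(1)
  proof (induction arbitrary: ps rule: list_all2_induct)
    case Nil
    then show ?case by (intro pra_refl) auto
  next
    case (Cons t ts u us)
    have wf: "wf_trm t'" if "t' \<in> set ts" for t'
      using Cons.hyps that by (metis in_set_conv_nth list_all2_conv_all_nth pra_wfD(1))
    obtain x where x: "x \<notin> \<Union> (vars ` set (ps @ ts))"
      using fresh_var finite_vars by (metis finite_UN_I List.finite_set)
    then have *: "map (subst x A) ps = ps" "map (subst x A) ts = ts" for A
      by (auto intro!: map_idI subst_fresh)
    have "pra (subst x t (App f (ps @ Var x # ts)) \<approx> subst x u (App f (ps @ Var x # ts)))"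
      using Cons wf by (intro pra_replace) auto
    then have "pra (App f (ps @ t # ts) \<approx> App f (ps @ u # ts))" by (simp add: *)
    moreover have "pra (App f ((ps @ [u]) @ ts) \<approx> App f ((ps @ [u]) @ us))"
      using Cons by (intro Cons.IH) (auto dest: pra_wfD)
    ultimately show ?case using pra_tran by auto
  qed
  from this[of "[]"] assms(2) show ?thesis by simp
qed

section \<open>The Lindenbaum algebra\<close>

typedef lindenbaum = "{{u. pra (t \<approx> u)} | t. wf_trm t}"
  by (auto intro: exI[of _ "Var 0"])

definition cls :: "trm \<Rightarrow> lindenbaum" where
  "cls t = Abs_lindenbaum {u. pra (t \<approx> u)}"

text \<open>
  Choosing representatives allows functions with any number of arguments to be defined on classes, by a
  single function on lists.
\<close>
definition rep :: "lindenbaum \<Rightarrow> trm" where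
  "rep a = (SOME t. wf_trm t \<and> cls t = a)"

lemma wf_rep [simp]: "wf_trm (rep a)" and cls_rep [simp]: "cls (rep a) = a"
proof -
  have "\<exists>t. wf_trm t \<and> cls t = a"
    using Rep_lindenbaum[of a] by (auto simp: cls_def Rep_lindenbaum_inverse) (metis Rep_lindenbaum_inverse)
  then show "wf_trm (rep a)" "cls (rep a) = a"
    unfolding rep_def by (metis (mono_tags, lifting) someI_ex)+
qed

lemma cls_eq_iff: "wf_trm t \<Longrightarrow> wf_trm u \<Longrightarrow> cls t = cls u \<longleftrightarrow> pra (t \<approx> u)"
proof -
  assume wf: "wf_trm t" "wf_trm u"
  then have "cls t = cls u \<longleftrightarrow> {v. pra (t \<approx> v)} = {v. pra (u \<approx> v)}"
    unfolding cls_def by (intro Abs_lindenbaum_inject) auto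
  also have "\<dots> \<longleftrightarrow> pra (t \<approx> u)"
    using wf pra_refl pra_sym pra_tran by (metis (mono_tags, lifting) Collect_cong mem_Collect_eq)
  finally show ?thesis .
qed

definition ap :: "sym \<Rightarrow> lindenbaum list \<Rightarrow> lindenbaum" where
  "ap f as = cls (App f (map rep as))"

lemma ap_cls:
  assumes "PR (length ts) f" "\<forall>t \<in> set ts. wf_trm t"
  shows "ap f (map cls ts) = cls (App f ts)"
proof -
  have "pra (App f (map rep (map cls ts)) \<approx> App f ts)"
  proof (rule pra_App_cong)
    show "list_all2 (\<lambda>t u. pra (t \<approx> u)) (map rep (map cls ts)) ts"
      unfolding list_all2_conv_all_nth using assms(2) by (auto simp flip: cls_eq_iff)
  qed (use assms in simp)
  then show ?thesis unfolding ap_def using assms by (subst cls_eq_iff) auto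
qed

abbreviation zr :: lindenbaum where "zr \<equiv> ap ZeroSym []"
abbreviation sc :: "lindenbaum \<Rightarrow> lindenbaum" where "sc a \<equiv> ap Succ [a]"

lemma PR_simps [simp]: "PR 0 ZeroSym" "PR (Suc 0) Null" "PR (Suc 0) Succ"
  "0 < k \<Longrightarrow> k \<le> n \<Longrightarrow> m = n \<Longrightarrow> PR m (Proj n k)"
  using PR.intros(1-4) by auto

lemma PR_Rec: "PR n g \<Longrightarrow> PR (Suc (Suc n)) h \<Longrightarrow> PR (Suc n) (Rec g h)"
  using PR.rec by simp

text \<open>
  The rules for function symbols hold as equations in the algebra; the laws for the individual symbols
  below are instances.
\<close>
lemma ap_unfold:
  assumes "unfolds (App f ts) Q" "wf_trm (App f ts)" "wf_trm Q"
  shows "ap f (map cls ts) = cls Q"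
  using assms by (subst ap_cls) (auto simp: cls_eq_iff intro: pra_unfold)

lemma zr_cls: "zr = cls zero" by (simp add: ap_def)

lemma sc_cls: "wf_trm t \<Longrightarrow> sc (cls t) = cls (succ t)"
  using ap_cls[of "[t]" Succ] by simp

lemma ap_Proj [simp]:
  assumes "0 < k" "k \<le> n" "length as = n"
  shows "ap (Proj n k) as = as ! (k - 1)"
proof -
  have "ap (Proj n k) (map cls (map rep as)) = cls (map rep as ! (k - 1))"
    by (rule ap_unfold[OF unfolds.intros(2)]) (use assms in auto)
  then show ?thesis using assms by (simp add: comp_def)
qed

lemma ap_Null [simp]: "ap Null [a] = zr"
  using ap_unfold[of Null "[rep a]" zero] by (auto simp: zr_cls intro!: unfolds.intros)

lemma ap_Comp:
  assumes "PR (length fs) g" "length fs > 1" "\<And>f. f \<in> set fs \<Longrightarrow> PR (length as) f"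
  shows "ap (Comp g fs) as = ap g (map (\<lambda>f. ap f as) fs)"
proof -
  have "ap (Comp g fs) (map cls (map rep as)) = cls (App g (map (\<lambda>f. App f (map rep as)) fs))"
    by (rule ap_unfold) (use assms in \<open>auto intro!: unfolds.intros PR.comp\<close>)
  also have "\<dots> = ap g (map cls (map (\<lambda>f. App f (map rep as)) fs))"
    by (rule ap_cls[symmetric]) (use assms in auto)
  also have "map cls (map (\<lambda>f. App f (map rep as)) fs) = map (\<lambda>f. ap f as) fs"
    by (simp add: ap_def)
  finally show ?thesis by (simp add: comp_def)
qed

lemma ap_Rec_zero:
  assumes "PR (length as) g" "PR (length as + 2) h"
  shows "ap (Rec g h) (as @ [zr]) = ap g as"
proof -
  have "ap (Rec g h) (map cls (map rep as @ [zero])) = cls (App g (map rep as))"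
    by (rule ap_unfold) (use assms in \<open>auto intro!: unfolds.intros PR_Rec\<close>)
  then show ?thesis by (simp add: comp_def zr_cls ap_def)
qed

lemma ap_Rec_succ:
  assumes "PR (length as) g" "PR (length as + 2) h"
  shows "ap (Rec g h) (as @ [sc a]) = ap h (as @ [a, ap (Rec g h) (as @ [a])])"
proof -
  let ?ts = "map rep as" and ?r = "App (Rec g h) (map rep as @ [rep a])"
  have wf: "wf_trm ?r" using assms by (auto intro!: PR_Rec)
  have "ap (Rec g h) (map cls (?ts @ [succ (rep a)])) = cls (App h (?ts @ [rep a, ?r]))"
    by (rule ap_unfold) (use assms wf in \<open>auto intro!: unfolds.intros PR_Rec\<close>)
  also have "\<dots> = ap h (map cls (?ts @ [rep a, ?r]))"
    by (rule ap_cls[symmetric]) (use assms wf in auto)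
  also have "map cls (?ts @ [rep a, ?r]) = as @ [a, ap (Rec g h) (as @ [a])]"
    by (simp add: comp_def ap_def)
  finally show ?thesis by (simp add: comp_def flip: sc_cls)
qed

type_synonym env = "nat \<Rightarrow> lindenbaum"

primrec ev :: "env \<Rightarrow> trm \<Rightarrow> lindenbaum" where
  "ev e (Var x) = e x"
| "ev e (App f ts) = ap f (map (ev e) ts)"

definition var :: "nat \<Rightarrow> lindenbaum" where
  "var x = cls (Var x)"

text \<open>
  Under the generic environment a term denotes its own class, so equations that hold in the algebra for
  all environments are provable.
\<close>
lemma ev_var: "wf_trm t \<Longrightarrow> ev var t = cls t"
proof (induction t)
  case (App f ts)
  then have "map (ev var) ts = map cls ts" by auto
  then have "ev var (App f ts) = ap f (map cls ts)" by (simp only: ev.simps)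
  then show ?case using App.prems ap_cls by simp
qed (simp add: var_def)

lemma ev_subst: "ev e (subst x A t) = ev (e(x := ev e A)) t"
  by (induction t) (auto intro!: arg_cong[of _ _ "ap f" for f])

lemma ev_cong: "(\<And>x. x \<in> vars t \<Longrightarrow> e x = e' x) \<Longrightarrow> ev e t = ev e' t"
proof (induction t)
  case (App f ts)
  have "ev e t = ev e' t" if "t \<in> set ts" for t
    using that by (intro App.IH App.prems) auto
  then have "map (ev e) ts = map (ev e') ts" by simp
  then show ?case by (simp only: ev.simps)
qed simp

section \<open>Polynomial functions and uniqueness of recursion\<close>

text \<open>
  Functions given by terms with elements of the algebra as parameters. The arguments are supplied by an
  environment, so that functions of any number of variables share one type and composition needs no
  renaming.
\<close>
inductive poly_fun :: "(env \<Rightarrow> lindenbaum) \<Rightarrow> bool" where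
  poly_fun_const: "poly_fun (\<lambda>e. c)"
| poly_fun_arg: "poly_fun (\<lambda>e. e i)"
| poly_fun_ap: "PR (length Fs) f \<Longrightarrow> (\<And>F. F \<in> set Fs \<Longrightarrow> poly_fun F) \<Longrightarrow> poly_fun (\<lambda>e. ap f (map (\<lambda>F. F e) Fs))"

text \<open>
  Parameters are represented by terms with variables of their own, which must not be captured. So for
  every sufficiently large \<open>N\<close> the arguments can be taken to be the variables from \<open>N\<close> on, while the variables
  below \<open>N\<close> are reserved for the parameters. Allowing all large \<open>N\<close> makes it possible to treat several
  functions at once.
\<close>
lemma poly_fun_as_term:
  assumes "poly_fun F"
  shows "\<exists>N0. \<forall>N\<ge>N0. \<exists>G. wf_trm G \<and> (\<forall>e. F e = ev (\<lambda>v. if v < N then var v else e (v - N)) G)"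
  using assms
proof (induction rule: poly_fun.induct)
  case (poly_fun_const c)
  obtain N0 where N0: "\<forall>x \<in> vars (rep c). x < N0"
    using finite_vars finite_nat_set_iff_bounded by blast
  have "c = ev (\<lambda>v. if v < N then var v else e (v - N)) (rep c)" if "N \<ge> N0" for N e
  proof -
    have "ev (\<lambda>v. if v < N then var v else e (v - N)) (rep c) = ev var (rep c)"
      using that N0 by (intro ev_cong) auto
    then show ?thesis by (simp add: ev_var)
  qed
  then show ?case using wf_rep by blast
next
  case (poly_fun_arg i)
  have "\<exists>G. wf_trm G \<and> (\<forall>e. e i = ev (\<lambda>v. if v < N then var v else e (v - N)) G)" for N
    by (rule exI[of _ "Var (N + i)"]) simp
  then show ?case by blast
next
  case (poly_fun_ap Fs f)
  then obtain n where n: "\<And>F N. F \<in> set Fs \<Longrightarrow> N \<ge> n F \<Longrightarrow>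
      \<exists>G. wf_trm G \<and> (\<forall>e. F e = ev (\<lambda>v. if v < N then var v else e (v - N)) G)" by metis
  have "\<exists>G. wf_trm G \<and> (\<forall>e. ap f (map (\<lambda>F. F e) Fs) = ev (\<lambda>v. if v < N then var v else e (v - N)) G)"
    if N: "N \<ge> Max (n ` set Fs)" for N
  proof -
    have "n F \<le> N" if "F \<in> set Fs" for F
      by (rule le_trans[OF Max_ge N]) (use that in auto)
    then have "\<forall>F \<in> set Fs. \<exists>G. wf_trm G \<and>
        (\<forall>e. F e = ev (\<lambda>v. if v < N then var v else e (v - N)) G)"
      using n by blast
    from bchoice[OF this] obtain g where g: "\<forall>F \<in> set Fs. wf_trm (g F) \<and>
        (\<forall>e. F e = ev (\<lambda>v. if v < N then var v else e (v - N)) (g F))" ..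
    have "map (\<lambda>F. F e) Fs = map (ev (\<lambda>v. if v < N then var v else e (v - N))) (map g Fs)" for e
      using g by simp
    then show ?thesis using g poly_fun_ap.hyps
      by (intro exI[of _ "App f (map g Fs)"]) (simp del: map_map)
  qed
  then show ?case by blast
qed

lemma poly_fun_compose:
  assumes "poly_fun F" "\<And>i. poly_fun (S i)"
  shows "poly_fun (\<lambda>e. F (\<lambda>i. S i e))"
  using assms(1)
proof (induction rule: poly_fun.induct)
  case (poly_fun_ap Fs f)
  have "poly_fun (\<lambda>e. ap f (map (\<lambda>F. F e) (map (\<lambda>F e. F (\<lambda>i. S i e)) Fs)))"
    by (rule poly_fun.poly_fun_ap) (use poly_fun_ap in auto)
  then show ?case by (simp add: comp_def)
qed (auto intro: assms poly_fun.intros)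

lemma poly_fun_compose1: "poly_fun (\<lambda>e. F (e 0)) \<Longrightarrow> poly_fun G \<Longrightarrow> poly_fun (\<lambda>e. F (G e))"
  using poly_fun_compose[of "\<lambda>e. F (e 0)" "\<lambda>_. G"] by simp

text \<open>
  This is rule \<open>(ind)\<close>. Premises about all elements of the algebra yield the premises of the rule at the class
  of its variable, and the conclusion of the rule passes to all elements by \<open>(sub)\<close>.
\<close>
lemma recursion_unique:
  assumes "poly_fun (\<lambda>e. F (e 0))" "poly_fun (\<lambda>e. H (e 0))" "poly_fun (\<lambda>e. J (e 0) (e 1))"
    and "F zr = H zr" "\<And>a. F (sc a) = J a (F a)" "\<And>a. J a (H a) = H (sc a)"
  shows "F a = H a"
proof -
  obtain N1 N2 N3 where N: "\<forall>N\<ge>N1. \<exists>G. wf_trm G \<and> (\<forall>e. F (e 0) = ev (\<lambda>v. if v < N then var v else e (v - N)) G)"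
    "\<forall>N\<ge>N2. \<exists>G. wf_trm G \<and> (\<forall>e. H (e 0) = ev (\<lambda>v. if v < N then var v else e (v - N)) G)"
    "\<forall>N\<ge>N3. \<exists>G. wf_trm G \<and> (\<forall>e. J (e 0) (e 1) = ev (\<lambda>v. if v < N then var v else e (v - N)) G)"
    using assms(1-3)[THEN poly_fun_as_term] by blast
  \<comment> \<open>the variables of the rule: beyond all variables of the parameters, for the three functions at once\<close>
  define x y where "x = max N1 (max N2 N3)" and "y = Suc x"
  have le: "N1 \<le> x" "N2 \<le> x" "N3 \<le> x" by (auto simp: x_def)
  obtain tF where F': "wf_trm tF" "\<And>e. F (e 0) = ev (\<lambda>v. if v < x then var v else e (v - x)) tF"
    using N(1) le(1) by blast
  obtain tH where H': "wf_trm tH" "\<And>e. H (e 0) = ev (\<lambda>v. if v < x then var v else e (v - x)) tH"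
    using N(2) le(2) by blast
  obtain tJ where J': "wf_trm tJ" "\<And>e. J (e 0) (e 1) = ev (\<lambda>v. if v < x then var v else e (v - x)) tJ"
    using N(3) le(3) by blast
  note wf = F'(1) H'(1) J'(1)
  have env1: "(\<lambda>v. if v < x then var v else ((\<lambda>i. var (x + i))(0 := a)) (v - x)) = var(x := a)" for a
    by (auto simp: fun_eq_iff)
  have env2: "(\<lambda>v. if v < x then var v else ((\<lambda>i. var (x + i))(0 := a, 1 := b)) (v - x))
      = var(x := a, y := b)" for a b
    by (auto simp: fun_eq_iff y_def)
  have F: "F a = ev (var(x := a)) tF" for a
    using F'(2)[of "(\<lambda>i. var (x + i))(0 := a)", unfolded env1] by simp
  have H: "H a = ev (var(x := a)) tH" for a
    using H'(2)[of "(\<lambda>i. var (x + i))(0 := a)", unfolded env1] by simp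
  have J: "J a b = ev (var(x := a, y := b)) tJ" for a b
    using J'(2)[of "(\<lambda>i. var (x + i))(0 := a, 1 := b)", unfolded env2] by simp
  have pra_ev: "pra (t \<approx> u)" if "wf_trm t" "wf_trm u" "ev var t = ev var u" for t u
    using that by (simp add: ev_var cls_eq_iff)
  have "pra (tF \<approx> tH)"
  proof (rule pra_step[OF _ _ infer.ind[of x y tF tH tJ]])
    have "pra (subst x zero tF \<approx> subst x zero tH)"
      by (rule pra_ev) (use wf assms(4) in \<open>auto simp: ev_subst intro!: wf_subst simp flip: F H\<close>)
    moreover have "pra (subst x (succ (Var x)) tF \<approx> subst y tF tJ)"
    proof (rule pra_ev)
      have "ev var (subst y tF tJ) = J (var x) (F (var x))" by (simp add: J F ev_subst)
      then show "ev var (subst x (succ (Var x)) tF) = ev var (subst y tF tJ)"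
        using assms(5) by (simp add: ev_subst flip: F)
    qed (use wf in \<open>auto intro!: wf_subst\<close>)
    moreover have "pra (subst y tH tJ \<approx> subst x (succ (Var x)) tH)"
    proof (rule pra_ev)
      have "ev var (subst y tH tJ) = J (var x) (H (var x))" by (simp add: J H ev_subst)
      then show "ev var (subst y tH tJ) = ev var (subst x (succ (Var x)) tH)"
        using assms(6) by (simp add: ev_subst flip: H)
    qed (use wf in \<open>auto intro!: wf_subst\<close>)
    ultimately show "pra e" if "e \<in> set [subst x zero tF \<approx> subst x zero tH,
        subst x (succ (Var x)) tF \<approx> subst y tF tJ, subst y tH tJ \<approx> subst x (succ (Var x)) tH]" for e
      using that by auto
  qed (use wf in \<open>auto simp: wf_eqn_def y_def\<close>)
  then have "pra (subst x (rep a) tF \<approx> subst x (rep a) tH)" by (rule pra_subst) simp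
  then have "ev var (subst x (rep a) tF) = ev var (subst x (rep a) tH)"
    using pra_wfD by (simp add: ev_var cls_eq_iff)
  then show ?thesis by (simp add: F H ev_subst ev_var)
qed

section \<open>Definition by cases and decidable equality\<close>

definition CND :: sym where "CND = Rec (Proj 2 1) (Proj 4 2)"
definition PRD :: sym where "PRD = Rec ZeroSym (Proj 2 1)"

text \<open>
  Composition of a unary symbol \<open>f\<close> with \<open>g\<close>. The scheme \<open>C\<close> asks for a head symbol of at least two
  arguments, so \<open>f\<close> is first made binary: \<open>R(f, I)\<close>, with \<open>I\<close> the last ternary projection, ignores its
  second argument.
\<close>
definition Comp1 :: "sym \<Rightarrow> sym \<Rightarrow> sym" where
  "Comp1 f g = Comp (Rec f (Proj 3 3)) [g, g]"

text \<open>
  Truncated subtraction; like addition below, it recurses on the second argument.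
\<close>
definition MNS :: sym where "MNS = Rec (Proj 1 1) (Comp1 PRD (Proj 3 3))"
definition PLS :: sym where "PLS = Rec (Proj 1 1) (Comp1 Succ (Proj 3 3))"

abbreviation cnd :: "lindenbaum \<Rightarrow> lindenbaum \<Rightarrow> lindenbaum \<Rightarrow> lindenbaum" where "cnd c a b \<equiv> ap CND [a, b, c]"
abbreviation prd :: "lindenbaum \<Rightarrow> lindenbaum" where "prd a \<equiv> ap PRD [a]"
abbreviation mns :: "lindenbaum \<Rightarrow> lindenbaum \<Rightarrow> lindenbaum" where "mns a b \<equiv> ap MNS [a, b]"
abbreviation pls :: "lindenbaum \<Rightarrow> lindenbaum \<Rightarrow> lindenbaum" where "pls a b \<equiv> ap PLS [a, b]"
abbreviation one :: lindenbaum where "one \<equiv> sc zr"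

named_theorems poly_fun_intros

lemma PR_CND [simp]: "PR 3 CND" "PR (Suc (Suc (Suc 0))) CND"
  using PR_Rec[of 2 "Proj 2 1" "Proj 4 2"] by (simp_all add: CND_def numeral_eq_Suc)

lemma PR_PRD [simp]: "PR (Suc 0) PRD"
  using PR_Rec[of 0 ZeroSym "Proj 2 1"] by (simp add: PRD_def numeral_eq_Suc)

lemma PR_Comp1: "PR 1 f \<Longrightarrow> PR n g \<Longrightarrow> PR n (Comp1 f g)"
  using PR_Rec[of 1 f "Proj 3 3"] unfolding Comp1_def
  by (intro PR.comp[of 2]) (auto simp: numeral_eq_Suc)

lemma PR_MNS [simp]: "PR (Suc (Suc 0)) MNS"
  using PR_Rec[of 1 "Proj 1 1" "Comp1 PRD (Proj 3 3)"] PR_Comp1[of PRD 3 "Proj 3 3"]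
  by (simp add: MNS_def numeral_eq_Suc)

lemma PR_PLS [simp]: "PR (Suc (Suc 0)) PLS"
  using PR_Rec[of 1 "Proj 1 1" "Comp1 Succ (Proj 3 3)"] PR_Comp1[of Succ 3 "Proj 3 3"]
  by (simp add: PLS_def numeral_eq_Suc)

lemma poly_fun_ap1 [poly_fun_intros]: "PR (Suc 0) f \<Longrightarrow> poly_fun F \<Longrightarrow> poly_fun (\<lambda>e. ap f [F e])"
  using poly_fun_ap[of "[F]" f] by simp

lemma poly_fun_ap2 [poly_fun_intros]: "PR (Suc (Suc 0)) f \<Longrightarrow> poly_fun F \<Longrightarrow> poly_fun G \<Longrightarrow> poly_fun (\<lambda>e. ap f [F e, G e])"
  using poly_fun_ap[of "[F, G]" f] by auto

lemma poly_fun_ap3 [poly_fun_intros]: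
  "PR (Suc (Suc (Suc 0))) f \<Longrightarrow> poly_fun F \<Longrightarrow> poly_fun G \<Longrightarrow> poly_fun H \<Longrightarrow> poly_fun (\<lambda>e. ap f [F e, G e, H e])"
  using poly_fun_ap[of "[F, G, H]" f] by auto

declare poly_fun_const [poly_fun_intros] poly_fun_arg [poly_fun_intros]

text \<open>
  Recursion whose step ignores the previous value: the rule \<open>(case)\<close> without cyclic reasoning.
\<close>
lemma zero_succ_cases:
  assumes "poly_fun (\<lambda>e. F (e 0))" "poly_fun (\<lambda>e. H (e 0))" "F zr = H zr" "\<And>a. F (sc a) = H (sc a)"
  shows "F a = H a"
  by (rule recursion_unique[where J = "\<lambda>a _. H (sc a)"])
    (use assms in \<open>auto intro!: poly_fun_compose1[of H "\<lambda>e. sc (e 0)"] poly_fun_intros\<close>)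

lemma cnd_zr [simp]: "cnd zr a b = a"
  using ap_Rec_zero[of "[a, b]" "Proj 2 1" "Proj 4 2"] by (simp add: CND_def)

lemma cnd_sc [simp]: "cnd (sc c) a b = b"
  using ap_Rec_succ[of "[a, b]" "Proj 2 1" "Proj 4 2" c] by (simp add: CND_def)

lemma prd_zr [simp]: "prd zr = zr"
  using ap_Rec_zero[of "[]" ZeroSym "Proj 2 1"] by (simp add: PRD_def)

lemma prd_sc [simp]: "prd (sc a) = a"
  using ap_Rec_succ[of "[]" ZeroSym "Proj 2 1" a] by (simp add: PRD_def)

lemma ap_Rec_const:
  assumes f: "PR (Suc 0) f"
  shows "ap (Rec f (Proj 3 3)) [a, b] = ap f [a]"
proof -
  have PR: "PR (Suc (Suc 0)) (Rec f (Proj 3 3))" using f by (intro PR_Rec) auto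
  show ?thesis
  proof (rule recursion_unique[where F = "\<lambda>b. ap (Rec f (Proj 3 3)) [a, b]" and J = "\<lambda>_ r. r"])
    show "ap (Rec f (Proj 3 3)) [a, zr] = ap f [a]"
      using ap_Rec_zero[of "[a]" f "Proj 3 3"] f by simp
    show "ap (Rec f (Proj 3 3)) [a, sc b] = ap (Rec f (Proj 3 3)) [a, b]" for b
      using ap_Rec_succ[of "[a]" f "Proj 3 3" b] f by simp
  qed (auto intro!: poly_fun_intros f PR)
qed

lemma ap_Comp1:
  assumes "PR (Suc 0) f" "PR (length as) g"
  shows "ap (Comp1 f g) as = ap f [ap g as]"
proof -
  have "PR (Suc (Suc 0)) (Rec f (Proj 3 3))" using assms by (intro PR_Rec) auto
  then have "ap (Comp (Rec f (Proj 3 3)) [g, g]) as = ap (Rec f (Proj 3 3)) [ap g as, ap g as]"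
    using assms by (subst ap_Comp) auto
  then show ?thesis using assms by (simp add: Comp1_def ap_Rec_const)
qed

lemma PR_Comp1_Proj: "PR (Suc 0) f \<Longrightarrow> PR 3 (Comp1 f (Proj 3 3))"
  "PR (Suc 0) f \<Longrightarrow> PR (Suc (Suc (Suc 0))) (Comp1 f (Proj 3 3))"
  using PR_Comp1[of f 3 "Proj 3 3"] by (simp_all add: numeral_3_eq_3)

lemma mns_zr [simp]: "mns a zr = a"
  using ap_Rec_zero[of "[a]" "Proj 1 1" "Comp1 PRD (Proj 3 3)"]
  by (simp add: MNS_def PR_Comp1_Proj)

lemma mns_sc [simp]: "mns a (sc b) = prd (mns a b)"
  using ap_Rec_succ[of "[a]" "Proj 1 1" "Comp1 PRD (Proj 3 3)" b]
  by (simp add: MNS_def PR_Comp1_Proj ap_Comp1)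

lemma pls_zr [simp]: "pls a zr = a"
  using ap_Rec_zero[of "[a]" "Proj 1 1" "Comp1 Succ (Proj 3 3)"]
  by (simp add: PLS_def PR_Comp1_Proj)

lemma pls_sc [simp]: "pls a (sc b) = sc (pls a b)"
  using ap_Rec_succ[of "[a]" "Proj 1 1" "Comp1 Succ (Proj 3 3)" b]
  by (simp add: PLS_def PR_Comp1_Proj ap_Comp1)

lemma cnd_idem [simp]: "cnd c a a = a"
  by (rule zero_succ_cases[where F = "\<lambda>c. cnd c a a"]) (auto intro!: poly_fun_intros)

lemma mns_sc_sc: "mns (sc a) (sc b) = mns a b"
  by (rule recursion_unique[where F = "\<lambda>b. mns (sc a) (sc b)" and J = "\<lambda>_ r. prd r"]) (auto intro!: poly_fun_intros)

lemma mns_sc_self: "mns (sc a) a = one"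
  by (rule recursion_unique[where F = "\<lambda>a. mns (sc a) a" and J = "\<lambda>_ r. r"])
    (auto intro!: poly_fun_intros simp: mns_sc_sc simp del: mns_sc)

lemma pls_sc_left: "pls (sc a) b = sc (pls a b)"
  by (rule recursion_unique[where F = "\<lambda>b. pls (sc a) b" and J = "\<lambda>_ r. sc r"]) (auto intro!: poly_fun_intros)

text \<open>
  If the difference of \<open>a\<close> and \<open>b\<close> is positive, adding \<open>b\<close> to it gives back \<open>a\<close>. In contrast to the general
  equation for the maximum, this can be shown by recursion on \<open>b\<close> with \<open>a\<close> fixed: passing to the successor
  of \<open>b\<close> changes the left-hand side only when the difference drops to zero, and then it is \<open>a\<close> by
  definition.
\<close>
lemma mns_pls: "cnd (mns a b) a (pls (mns a b) b) = a"
proof (rule recursion_unique[where F = "\<lambda>b. cnd (mns a b) a (pls (mns a b) b)"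
      and J = "\<lambda>b r. cnd (prd (mns a b)) a r"])
  fix b
  have "cnd (prd w) a (sc (pls (prd w) b)) = cnd (prd w) a (cnd w a (pls w b))" for w
    by (rule zero_succ_cases[where F = "\<lambda>w. cnd (prd w) a (sc (pls (prd w) b))"])
      (auto intro!: poly_fun_intros simp: pls_sc_left)
  then show "cnd (mns a (sc b)) a (pls (mns a (sc b)) (sc b))
      = cnd (prd (mns a b)) a (cnd (mns a b) a (pls (mns a b) b))" by simp
qed (auto intro!: poly_fun_intros)

text \<open>
  Both terms are designed so that equality can be decided without a double recursion. The value of
  \<open>tst\<close> is zero at one and positive elsewhere, and \<open>a\<close> equals \<open>b\<close> exactly if the difference of \<open>s(a)\<close> and \<open>b\<close> is
  one.
\<close>
abbreviation tst :: "lindenbaum \<Rightarrow> lindenbaum" where "tst w \<equiv> cnd w one (prd w)"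
abbreviation dist :: "lindenbaum \<Rightarrow> lindenbaum \<Rightarrow> lindenbaum" where "dist a b \<equiv> tst (mns (sc a) b)"

lemma dist_self: "dist a a = zr"
  by (simp add: mns_sc_self)

text \<open>
  If the difference \<open>w\<close> of \<open>s(a)\<close> and \<open>b\<close> is one, then \<open>w + b = s(a)\<close> by \<open>mns_pls\<close>, so the predecessor
  of \<open>w + b\<close> is both \<open>a\<close> and \<open>b\<close>. The claim is therefore first stated with this expression in place of \<open>a\<close>,
  which makes sense for every \<open>w\<close> and is proved by cases on \<open>w\<close>.
\<close>
lemma cnd_dist: "cnd (dist a b) a b = b"
proof -
  have "cnd (tst w) (prd (cnd w (sc a) (pls w b))) b = b" for w
  proof (rule zero_succ_cases[where F = "\<lambda>w. cnd (tst w) (prd (cnd w (sc a) (pls w b))) b"])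
    show "cnd (tst (sc v)) (prd (cnd (sc v) (sc a) (pls (sc v) b))) b = b" for v
    proof -
      have "cnd v (pls v b) b = b"
      proof (rule zero_succ_cases[where F = "\<lambda>v. cnd v (pls v b) b"])
        show "cnd zr (pls zr b) b = b"
          by simp (rule recursion_unique[where F = "\<lambda>b. pls zr b" and J = "\<lambda>_ r. sc r"]; auto intro!: poly_fun_intros)
      qed (auto intro!: poly_fun_intros)
      then show ?thesis by (simp add: pls_sc_left)
    qed
  qed (auto intro!: poly_fun_intros)
  from this[of "mns (sc a) b"] show ?thesis by (simp add: mns_pls)
qed

section \<open>Conditional equations\<close>

text \<open>
  The conditional equation ``if \<open>c = 0\<close> then \<open>a = b\<close>''. In particular \<open>imp c d zr\<close> is the implication between
  the conditions \<open>c = 0\<close> and \<open>d = 0\<close>, and \<open>cnd c d zr\<close> is a term whose vanishing expresses it.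
\<close>
definition imp :: "lindenbaum \<Rightarrow> lindenbaum \<Rightarrow> lindenbaum \<Rightarrow> bool" where
  "imp c a b \<longleftrightarrow> cnd c a b = b"

lemma imp_refl [simp]: "imp c a a"
  by (simp add: imp_def)

lemma imp_zr [simp]: "imp zr a b \<longleftrightarrow> a = b"
  by (simp add: imp_def)

text \<open>
  This and most of the following laws come from an equation between nested \<open>cnd\<close>-terms, valid by cases
  on the condition.
\<close>
lemma imp_trans: "imp c a b \<Longrightarrow> imp c b d \<Longrightarrow> imp c a d"
proof -
  have "cnd c (cnd c a b) d = cnd c a d"
    by (rule zero_succ_cases[where F = "\<lambda>c. cnd c (cnd c a b) d"]) (auto intro!: poly_fun_intros)
  then show "imp c a b \<Longrightarrow> imp c b d \<Longrightarrow> imp c a d" by (simp add: imp_def)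
qed

lemma imp_sym: "imp c a b \<Longrightarrow> imp c b a"
proof -
  have "cnd c (cnd c a b) a = a"
    by (rule zero_succ_cases[where F = "\<lambda>c. cnd c (cnd c a b) a"]) (auto intro!: poly_fun_intros)
  then show "imp c a b \<Longrightarrow> imp c b a" by (simp add: imp_def)
qed

lemma imp_cong:
  assumes "poly_fun (\<lambda>e. F (e 0))" "imp c a b"
  shows "imp c (F a) (F b)"
proof -
  have "F (cnd c a b) = cnd c (F a) (F b)"
    by (rule zero_succ_cases[where F = "\<lambda>c. F (cnd c a b)"])
      (auto intro!: poly_fun_intros poly_fun_compose1[of F "\<lambda>e. cnd (e 0) a b"] assms(1))
  then show ?thesis using assms(2) by (simp add: imp_def)
qed

lemma imp_cnd: "imp c d zr \<Longrightarrow> imp c (cnd d a b) a"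
proof -
  assume *: "imp c d zr"
  have "poly_fun (\<lambda>e. cnd (e 0) a b)" by (auto intro!: poly_fun_intros)
  from imp_cong[where F = "\<lambda>z. cnd z a b", OF this *] show ?thesis by simp
qed

lemma imp_cut: "imp c d zr \<Longrightarrow> imp d a b \<Longrightarrow> imp c a b"
  using imp_sym[OF imp_cnd[of c d a b]] by (simp add: imp_def)

text \<open>
  Conjunction of the conditions \<open>c = 0\<close> and \<open>d = 0\<close>.
\<close>
abbreviation both :: "lindenbaum \<Rightarrow> lindenbaum \<Rightarrow> lindenbaum" where "both c d \<equiv> cnd c d one"

lemma bothD1: "imp (both c d) c zr"
  unfolding imp_def
  by (rule zero_succ_cases[where F = "\<lambda>c. cnd (both c d) c zr"]) (auto intro!: poly_fun_intros)

lemma cnd_self: "cnd c c zr = zr"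
  by (rule zero_succ_cases[where F = "\<lambda>c. cnd c c zr"]) (auto intro!: poly_fun_intros)

lemma imp_self: "imp c c zr"
  by (simp add: imp_def cnd_self)

lemma bothD2: "imp (both c d) d zr"
  unfolding imp_def
  by (rule zero_succ_cases[where F = "\<lambda>c. cnd (both c d) d zr"]) (auto intro!: poly_fun_intros simp: cnd_self)

lemma bothI: "imp c d zr \<Longrightarrow> imp c d' zr \<Longrightarrow> imp c (both d d') zr"
  using imp_cnd imp_trans by blast

lemma both_mono: "imp c c' zr \<Longrightarrow> imp d d' zr \<Longrightarrow> imp (both c d) (both c' d') zr"
  by (meson imp_cut bothD1 bothD2 bothI)

text \<open>
  The deduction theorem for conditions; \<open>imp_cndD\<close> is the corresponding modus ponens.
\<close>
lemma imp_cndI: "imp (both p c) a b \<Longrightarrow> imp p (cnd c a b) b"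
proof -
  have "cnd p (cnd c a b) b = cnd (both p c) a b"
    by (rule zero_succ_cases[where F = "\<lambda>p. cnd p (cnd c a b) b"]) (auto intro!: poly_fun_intros)
  then show "imp (both p c) a b \<Longrightarrow> imp p (cnd c a b) b" by (simp add: imp_def)
qed

lemma imp_cndD: "imp p (cnd c a b) b \<Longrightarrow> imp p c zr \<Longrightarrow> imp p a b"
  using imp_cnd imp_trans imp_sym by blast

lemma imp_dist_iff: "imp c (dist a b) zr \<longleftrightarrow> imp c a b"
proof
  show "imp c (dist a b) zr \<Longrightarrow> imp c a b"
    by (erule imp_cut) (simp add: imp_def cnd_dist)
  have "poly_fun (\<lambda>e. dist (e 0) b)" by (auto intro!: poly_fun_intros)
  from imp_cong[where F = "\<lambda>a. dist a b", OF this, of c a b]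
  show "imp c a b \<Longrightarrow> imp c (dist a b) zr" unfolding dist_self .
qed

text \<open>
  Induction for a condition \<open>T(a) = 0\<close>: under the hypothesis of the induction step, \<open>T\<close> and the constant zero
  satisfy the same recursion equations.
\<close>
lemma imp_induct:
  assumes "poly_fun (\<lambda>e. T (e 0))" "T zr = zr" "\<And>a. imp (T a) (T (sc a)) zr"
  shows "T a = zr"
proof (rule recursion_unique[where F = T and J = "\<lambda>a r. cnd r zr (T (sc a))"])
  show "T (sc a) = cnd (T a) zr (T (sc a))" for a
    using imp_sym[OF assms(3)] by (simp add: imp_def)
qed (auto intro!: poly_fun_intros assms poly_fun_compose1[of T "\<lambda>e. sc (e 0)"])

section \<open>Functions given by terms\<close>

text \<open>
  Composition builds a symbol only from heads with at least two arguments. Unary heads are handled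
  by \<open>Comp1\<close>, constants by making them unary first. This is also why \<open>n\<close> must be positive.
\<close>
lemma symbol_of_term:
  assumes "wf_trm t" "vars t \<subseteq> {..<n}" "0 < n"
  shows "\<exists>f. PR n f \<and> (\<forall>as. length as = n \<longrightarrow> ap f as = ev (\<lambda>i. as ! i) t)"
  using assms(1,2)
proof (induction t)
  case (Var i)
  then show ?case by (intro exI[of _ "Proj n (Suc i)"]) auto
next
  case (App f ts)
  then have "\<forall>t \<in> set ts. \<exists>f. PR n f \<and> (\<forall>as. length as = n \<longrightarrow> ap f as = ev (\<lambda>i. as ! i) t)"
    by (auto simp: UN_subset_iff)
  from bchoice[OF this] obtain g where g: "\<And>t. t \<in> set ts \<Longrightarrow> PR n (g t)"
    "\<And>t as. t \<in> set ts \<Longrightarrow> length as = n \<Longrightarrow> ap (g t) as = ev (\<lambda>i. as ! i) t"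
    by blast
  have f: "PR (length ts) f" using App.prems by simp
  consider "ts = []" | t where "ts = [t]" | "1 < length ts"
    by (cases ts rule: list.exhaust; cases "tl ts") auto
  then show ?case
  proof cases
    \<comment> \<open>\<open>R(f, I)\<close> is the unary constant function with value \<open>f\<close>\<close>
    case 1
    have PR: "PR 0 f" "PR (Suc 0) (Rec f (Proj 2 2))" using f 1 by (auto intro!: PR_Rec)
    have const: "ap (Rec f (Proj 2 2)) [a] = ap f []" for a
    proof (rule recursion_unique[where F = "\<lambda>a. ap (Rec f (Proj 2 2)) [a]" and J = "\<lambda>_ r. r"])
      show "ap (Rec f (Proj 2 2)) [zr] = ap f []"
        using ap_Rec_zero[of "[]" f "Proj 2 2"] PR by simp
      show "ap (Rec f (Proj 2 2)) [sc a] = ap (Rec f (Proj 2 2)) [a]" for a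
        using ap_Rec_succ[of "[]" f "Proj 2 2" a] PR by simp
    qed (auto intro!: poly_fun_intros PR)
    show ?thesis using 1 assms(3) PR const
      by (intro exI[of _ "Comp1 (Rec f (Proj 2 2)) (Proj n 1)"])
        (auto simp: ap_Comp1 Suc_le_eq intro!: PR_Comp1)
  next
    case (2 t)
    then show ?thesis using f g
      by (intro exI[of _ "Comp1 f (g t)"]) (auto simp: ap_Comp1 intro!: PR_Comp1)
  next
    case 3
    have "ap (Comp f (map g ts)) as = ev (\<lambda>i. as ! i) (App f ts)" if "length as = n" for as
    proof -
      have "ap (Comp f (map g ts)) as = ap f (map (\<lambda>f. ap f as) (map g ts))"
        using 3 f g(1) that by (intro ap_Comp) auto
      also have "map (\<lambda>f. ap f as) (map g ts) = map (ev (\<lambda>i. as ! i)) ts"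
        using g(2) that by simp
      finally show ?thesis by (simp only: ev.simps)
    qed
    moreover have "PR n (Comp f (map g ts))"
      using 3 f g(1) by (auto intro!: PR.comp)
    ultimately show ?thesis by blast
  qed
qed

text \<open>
  In contrast to \<open>poly_fun\<close>, there are no parameters: the variables of the term are the argument.
  Bounded quantification is available for these functions, and with some coordinates fixed they
  become polynomial functions of the others.
\<close>
definition term_fun :: "(env \<Rightarrow> lindenbaum) \<Rightarrow> bool" where
  "term_fun F \<longleftrightarrow> (\<exists>t. wf_trm t \<and> F = (\<lambda>e. ev e t))"

lemma term_fun_ev: "wf_trm t \<Longrightarrow> term_fun (\<lambda>e. ev e t)"
  by (auto simp: term_fun_def)

lemma term_fun_zr: "term_fun (\<lambda>e. zr)"
  using term_fun_ev[of zero] by simp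

lemma term_fun_ap1: "PR (Suc 0) f \<Longrightarrow> term_fun F \<Longrightarrow> term_fun (\<lambda>e. ap f [F e])"
  unfolding term_fun_def by clarify (rule_tac x = "App f [t]" in exI, simp)

lemma term_fun_ap2: "PR (Suc (Suc 0)) f \<Longrightarrow> term_fun F \<Longrightarrow> term_fun G \<Longrightarrow> term_fun (\<lambda>e. ap f [F e, G e])"
  unfolding term_fun_def by clarify (rule_tac x = "App f [t, ta]" in exI, simp)

lemma term_fun_ap3:
  "PR (Suc (Suc (Suc 0))) f \<Longrightarrow> term_fun F \<Longrightarrow> term_fun G \<Longrightarrow> term_fun H \<Longrightarrow> term_fun (\<lambda>e. ap f [F e, G e, H e])"
  unfolding term_fun_def by clarify (rule_tac x = "App f [t, ta, tb]" in exI, simp)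

lemmas term_fun_intros = term_fun_zr term_fun_ap1 term_fun_ap2 term_fun_ap3 term_fun_ev

lemma poly_fun_ev: "wf_trm t \<Longrightarrow> (\<And>v. poly_fun (\<lambda>e'. S e' v)) \<Longrightarrow> poly_fun (\<lambda>e'. ev (S e') t)"
proof (induction t)
  case (App f ts)
  have "poly_fun (\<lambda>e'. ap f (map (\<lambda>F. F e') (map (\<lambda>t e'. ev (S e') t) ts)))"
    by (rule poly_fun_ap) (use App in auto)
  then show ?case by (simp add: comp_def)
qed simp

lemma poly_fun_term_fun: "term_fun F \<Longrightarrow> (\<And>v. poly_fun (\<lambda>e'. S e' v)) \<Longrightarrow> poly_fun (\<lambda>e'. F (S e'))"
  by (auto simp: term_fun_def intro: poly_fun_ev)

lemma poly_fun_upd: "(\<And>v. poly_fun (\<lambda>e'. S e' v)) \<Longrightarrow> poly_fun T \<Longrightarrow> poly_fun (\<lambda>e'. ((S e')(x := T e')) v)"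
  by (cases "v = x") auto

lemma poly_fun_term_fun_upd: "term_fun F \<Longrightarrow> poly_fun (\<lambda>e'. F (e(x := e' 0)))"
  by (erule poly_fun_term_fun, rule poly_fun_upd) (auto intro!: poly_fun_intros)

section \<open>Bounded universal quantification\<close>

text \<open>
  The condition \<open>V = 0\<close> says that \<open>T = 0\<close> holds for all values of the variable \<open>y\<close> up to the present one.
\<close>
definition bounded_all :: "nat \<Rightarrow> (env \<Rightarrow> lindenbaum) \<Rightarrow> (env \<Rightarrow> lindenbaum) \<Rightarrow> bool" where
  "bounded_all y T V \<longleftrightarrow> (\<forall>e. V (e(y := zr)) = T (e(y := zr))) \<and>
     (\<forall>e a. V (e(y := sc a)) = both (V (e(y := a))) (T (e(y := sc a))))"

text \<open>
  Recursion takes place on an additional argument of the function symbol. The place that \<open>y\<close> has among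
  the first \<open>n\<close> arguments is filled with zero, so that the parameters of the recursion do not depend on \<open>y\<close>.
\<close>
lemma bounded_all_exists:
  assumes "term_fun T"
  shows "\<exists>V. term_fun V \<and> bounded_all y T V"
proof -
  obtain t where t: "wf_trm t" "T = (\<lambda>e. ev e t)" using assms by (auto simp: term_fun_def)
  obtain n where n: "\<forall>x \<in> insert y (vars t). x < n"
    using finite_vars finite_nat_set_iff_bounded by (metis finite_insert)
  have vars_subst: "vars (subst y u t) \<subseteq> vars t \<union> vars u" for u
    by (induction t) (auto split: if_splits)
  define one_t where "one_t = succ zero"
  define gt where "gt = subst y zero t"
  define ht where "ht = App CND [subst y (succ (Var n)) t, one_t, Var (n + 1)]"
  have "wf_trm gt" "vars gt \<subseteq> {..<n}" "0 < n"
    using t n vars_subst[of zero] by (auto simp: gt_def intro!: wf_subst)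
  then obtain g where g: "PR n g" "\<And>as. length as = n \<Longrightarrow> ap g as = ev (\<lambda>i. as ! i) gt"
    using symbol_of_term[of gt n] by metis
  have "wf_trm ht" using t by (simp add: ht_def one_t_def wf_subst)
  moreover have "x < n + 2" if "x \<in> vars (subst y (succ (Var n)) t)" for x
  proof -
    have "x \<in> vars t \<or> x = n" using that vars_subst[of "succ (Var n)"] by auto
    then show ?thesis using n by (auto simp: less_Suc_eq)
  qed
  then have "vars ht \<subseteq> {..<n + 2}" by (auto simp: ht_def one_t_def)
  ultimately obtain h where h: "PR (n + 2) h" "\<And>as. length as = n + 2 \<Longrightarrow> ap h as = ev (\<lambda>i. as ! i) ht"
    using symbol_of_term[of ht "n + 2"] zero_less_Suc by (metis add_2_eq_Suc')
  define args where "args e = map (\<lambda>i. if i = y then zr else e i) [0..<n]" for e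
  define V where "V e = ap (Rec g h) (args e @ [e y])" for e
  have args: "args (e(y := a)) = args e" "length (args e) = n" for e a
    by (auto simp: args_def)
  have V_upd: "V (e(y := a)) = ap (Rec g h) (args e @ [a])" for e a
    by (simp add: V_def args)
  have "V = (\<lambda>e. ev e (App (Rec g h) (map (\<lambda>i. if i = y then zero else Var i) [0..<n] @ [Var y])))"
    by (auto simp: V_def args_def fun_eq_iff comp_def if_distrib cong: if_cong
        intro!: arg_cong[of _ _ "ap f" for f])
  moreover have "wf_trm (App (Rec g h) (map (\<lambda>i. if i = y then zero else Var i) [0..<n] @ [Var y]))"
    using g(1) h(1) by (auto intro!: PR_Rec)
  ultimately have "term_fun V" unfolding term_fun_def by blast
  moreover have "bounded_all y T V"
    unfolding bounded_all_def
  proof (intro conjI allI)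
    fix e
    have "V (e(y := zr)) = ev (\<lambda>i. args e ! i) gt"
      unfolding V_upd using g h by (subst ap_Rec_zero) (auto simp: args)
    also have "\<dots> = ev (e(y := zr)) t"
      unfolding gt_def ev_subst by (rule ev_cong) (use n in \<open>auto simp: args_def\<close>)
    finally show "V (e(y := zr)) = T (e(y := zr))" by (simp add: t)
  next
    fix e a
    let ?as = "args e @ [a, V (e(y := a))]"
    have "V (e(y := sc a)) = ev (\<lambda>i. ?as ! i) ht"
      unfolding V_upd using g h by (subst ap_Rec_succ) (auto simp: args)
    also have "\<dots> = both (V (e(y := a))) (ev ((\<lambda>i. ?as ! i)(y := sc a)) t)"
      by (simp add: ht_def one_t_def ev_subst nth_append args)
    also have "ev ((\<lambda>i. ?as ! i)(y := sc a)) t = ev (e(y := sc a)) t"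
      by (rule ev_cong) (use n in \<open>auto simp: args nth_append\<close>, auto simp: args_def)
    finally show "V (e(y := sc a)) = both (V (e(y := a))) (T (e(y := sc a)))" by (simp only: t)
  qed
  ultimately show ?thesis by blast
qed

text \<open>
  The condition \<open>C = 0\<close> is inherited when the variable \<open>x\<close> is decreased by one.
\<close>
definition down_closed :: "nat \<Rightarrow> (env \<Rightarrow> lindenbaum) \<Rightarrow> bool" where
  "down_closed x C \<longleftrightarrow> (\<forall>e a. imp (C (e(x := sc a))) (C (e(x := a))) zr)"

lemma bounded_all_elim:
  assumes "term_fun T" "term_fun V" "bounded_all y T V"
  shows "imp (V e) (T e) zr"
proof -
  have "cnd (V (e(y := a))) (T (e(y := a))) zr = zr" for a
  proof (rule zero_succ_cases[where F = "\<lambda>a. cnd (V (e(y := a))) (T (e(y := a))) zr"])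
    show "cnd (V (e(y := sc a))) (T (e(y := sc a))) zr = zr" for a
      using assms(3) bothD2 by (simp add: bounded_all_def imp_def)
  qed (use assms(3) in \<open>auto intro!: poly_fun_intros poly_fun_term_fun_upd[OF assms(1)] poly_fun_term_fun_upd[OF assms(2)]
      simp: bounded_all_def cnd_self\<close>)
  from this[of "e y"] show ?thesis by (simp add: imp_def)
qed

lemma bounded_all_closed: "bounded_all y T V \<Longrightarrow> down_closed y V"
  by (simp add: bounded_all_def down_closed_def bothD1)

text \<open>
  Generalization: if a condition is inherited by smaller values, then whatever it implies holds for
  all smaller values as well. The proof is by induction on the bound.
\<close>
lemma bounded_all_intro:
  assumes "term_fun V" "bounded_all y T V" "poly_fun (\<lambda>e'. P (e' 0))"
    and "\<And>a. imp (P (sc a)) (P a) zr" "\<And>a. imp (P a) (T (e(y := a))) zr"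
  shows "imp (P a) (V (e(y := a))) zr"
proof -
  let ?V = "\<lambda>a. V (e(y := a))"
  have "cnd (P a) (?V a) zr = zr"
  proof (rule imp_induct[where T = "\<lambda>a. cnd (P a) (?V a) zr"])
    show "poly_fun (\<lambda>e'. cnd (P (e' 0)) (?V (e' 0)) zr)"
      using assms(3) by (auto intro!: poly_fun_intros poly_fun_term_fun_upd[OF assms(1)])
    show "cnd (P zr) (?V zr) zr = zr"
      using assms(2) assms(5)[of zr] by (simp add: bounded_all_def imp_def)
    show "imp (cnd (P a) (?V a) zr) (cnd (P (sc a)) (?V (sc a)) zr) zr" for a
    proof (rule imp_cndI)
      let ?h = "both (cnd (P a) (?V a) zr) (P (sc a))"
      have "imp ?h (?V a) zr"
        by (rule imp_cndD[OF bothD1 imp_cut[OF bothD2 assms(4)]])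
      moreover have "imp ?h (T (e(y := sc a))) zr"
        by (rule imp_cut[OF bothD2 assms(5)])
      ultimately show "imp ?h (?V (sc a)) zr"
        using assms(2) bothI by (simp add: bounded_all_def)
    qed
  qed
  then show ?thesis by (simp add: imp_def)
qed

text \<open>
  By \<open>bounded_all_intro\<close>, applied to \<open>V\<close> itself at the larger value of \<open>z\<close>.
\<close>
lemma bounded_all_closed_other:
  assumes "term_fun T" "term_fun V" "bounded_all y T V" "down_closed z T"
  shows "down_closed z V"
proof (cases "z = y")
  case False
  have "imp (V (e(z := sc b))) (V (e(z := b))) zr" for e b
  proof -
    have "imp (V (e(z := sc b, y := a))) (V (e(z := b, y := a))) zr" for a
    proof (rule bounded_all_intro[OF assms(2,3), where P = "\<lambda>a. V (e(z := sc b, y := a))"])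
      show "imp (V (e(z := sc b, y := sc a))) (V (e(z := sc b, y := a))) zr" for a
        using bounded_all_closed[OF assms(3)] by (simp add: down_closed_def)
      show "imp (V (e(z := sc b, y := a))) (T (e(z := b, y := a))) zr" for a
        using imp_cut[OF bounded_all_elim[OF assms(1-3)], of "e(z := sc b, y := a)"] assms(4) False
        by (simp add: down_closed_def fun_upd_twist)
    qed (auto intro!: poly_fun_term_fun_upd assms)
    from this[of "e y"] show ?thesis using False by (simp add: fun_upd_idem)
  qed
  then show ?thesis by (simp add: down_closed_def)
qed (use bounded_all_closed assms in blast)

text \<open>
  Quantification over several variables, characterized by elimination, heredity and generalization.
  The set \<open>K\<close> of environments restricts generalization to fixed values of variables
  that are not quantified.
\<close>
lemma bounded_all_list:
  assumes "term_fun T"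
  shows "\<exists>V. term_fun V \<and> (\<forall>e. imp (V e) (T e) zr) \<and> (\<forall>z. z \<in> set ys \<or> down_closed z T \<longrightarrow> down_closed z V) \<and>
    (\<forall>P K. (\<forall>e\<in>K. \<forall>y\<in>set ys. \<forall>a. e(y := a) \<in> K) \<longrightarrow>
       (\<forall>e. \<forall>y\<in>set ys. poly_fun (\<lambda>e'. P (e(y := e' 0)))) \<longrightarrow>
       (\<forall>e\<in>K. \<forall>y\<in>set ys. \<forall>a. imp (P (e(y := sc a))) (P (e(y := a))) zr) \<longrightarrow>
       (\<forall>e\<in>K. imp (P e) (T e) zr) \<longrightarrow> (\<forall>e\<in>K. imp (P e) (V e) zr))"
proof (induction ys)
  case Nil
  show ?case by (rule exI[of _ T]) (simp add: assms imp_self)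
next
  case (Cons y ys)
  then obtain U where U: "term_fun U" "\<forall>e. imp (U e) (T e) zr"
    "\<forall>z. z \<in> set ys \<or> down_closed z T \<longrightarrow> down_closed z U"
    "\<And>P K. \<lbrakk>\<forall>e\<in>K. \<forall>y\<in>set ys. \<forall>a. e(y := a) \<in> K; \<forall>e. \<forall>y\<in>set ys. poly_fun (\<lambda>e'. P (e(y := e' 0)));
       \<forall>e\<in>K. \<forall>y\<in>set ys. \<forall>a. imp (P (e(y := sc a))) (P (e(y := a))) zr;
       \<forall>e\<in>K. imp (P e) (T e) zr\<rbrakk> \<Longrightarrow> \<forall>e\<in>K. imp (P e) (U e) zr" by blast
  obtain V where V: "term_fun V" "bounded_all y U V" using bounded_all_exists U(1) by blast
  show ?case
  proof (intro exI[of _ V] conjI allI impI)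
    show "term_fun V" by fact
    show "imp (V e) (T e) zr" for e
      using imp_cut bounded_all_elim[OF U(1) V] U(2) by blast
    show "down_closed z V" if "z \<in> set (y # ys) \<or> down_closed z T" for z
      using that U(1,3) V bounded_all_closed bounded_all_closed_other by auto
    fix P K
    assume K: "\<forall>e\<in>K. \<forall>y\<in>set (y # ys). \<forall>a. e(y := a) \<in> K"
      and P: "\<forall>e. \<forall>y\<in>set (y # ys). poly_fun (\<lambda>e'. P (e(y := e' 0)))"
        "\<forall>e\<in>K. \<forall>y\<in>set (y # ys). \<forall>a. imp (P (e(y := sc a))) (P (e(y := a))) zr"
        "\<forall>e\<in>K. imp (P e) (T e) zr"
    have PU: "\<forall>e\<in>K. imp (P e) (U e) zr"
      by (rule U(4)) (use K P in auto)
    show "\<forall>e\<in>K. imp (P e) (V e) zr"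
    proof
      fix e assume "e \<in> K"
      then have "imp (P (e(y := a))) (V (e(y := a))) zr" for a
        by (intro bounded_all_intro[OF V, where P = "\<lambda>a. P (e(y := a))"]) (use K P PU in auto)
      from this[of "e y"] show "imp (P e) (V e) zr" by simp
    qed
  qed
qed

section \<open>Soundness of cyclic proofs\<close>

text \<open>
  Soundness of \<open>(case)\<close> with active variable \<open>x\<close> under a hereditary condition \<open>C\<close>. Let \<open>D = 0\<close> express
  \<open>A = B\<close>, let \<open>U\<close> quantify \<open>D\<close> over all other variables and \<open>V\<close> quantify \<open>U\<close> over \<open>x\<close>. Then \<open>C\<close> and \<open>V\<close> together
  are hereditary and imply \<open>A = B\<close>, so by \<open>step\<close> they imply \<open>A = B\<close> at the next value of \<open>x\<close>. Generalization over
  the other variables gives \<open>U\<close> there, and induction on \<open>x\<close> gives \<open>V\<close>. The other variables must be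
  quantified because they may be active further up.
\<close>
lemma case_sound:
  assumes C: "term_fun C" "\<And>z. down_closed z C" and wf: "wf_trm A" "wf_trm B"
    and base: "\<And>e. ev (e(x := zr)) A = ev (e(x := zr)) B"
    and step: "\<And>C' e. \<lbrakk>term_fun C'; \<And>z. down_closed z C'; \<And>e. imp (C' e) (C e) zr;
      \<And>e. imp (C' e) (ev e A) (ev e B)\<rbrakk> \<Longrightarrow> imp (C' e) (ev (e(x := sc (e x))) A) (ev (e(x := sc (e x))) B)"
  shows "imp (C e) (ev e A) (ev e B)"
proof -
  define D where "D e = dist (ev e A) (ev e B)" for e
  have term_funD: "term_fun D" unfolding D_def by (intro term_fun_intros wf) simp_all
  obtain n where n: "\<forall>x \<in> vars A \<union> vars B. x < n"
    using finite_vars finite_nat_set_iff_bounded by (metis finite_Un)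
  \<comment> \<open>\<open>D\<close> does not depend on variables from \<open>n\<close> on, so heredity in these is automatic\<close>
  define ys where "ys = removeAll x [0..<n]"
  obtain U where U: "term_fun U" "\<And>e. imp (U e) (D e) zr"
    "\<And>z. z \<in> set ys \<or> down_closed z D \<Longrightarrow> down_closed z U"
    "\<And>P K. \<lbrakk>\<forall>e\<in>K. \<forall>y\<in>set ys. \<forall>a. e(y := a) \<in> K; \<forall>e. \<forall>y\<in>set ys. poly_fun (\<lambda>e'. P (e(y := e' 0)));
       \<forall>e\<in>K. \<forall>y\<in>set ys. \<forall>a. imp (P (e(y := sc a))) (P (e(y := a))) zr;
       \<forall>e\<in>K. imp (P e) (D e) zr\<rbrakk> \<Longrightarrow> \<forall>e\<in>K. imp (P e) (U e) zr"
    using bounded_all_list[OF term_funD, of ys] by blast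
  obtain V where V: "term_fun V" "bounded_all x U V" using bounded_all_exists U(1) by blast
  have VU: "imp (V e) (U e) zr" for e using bounded_all_elim[OF U(1) V] .
  have closedU: "down_closed z U" if "z \<noteq> x" for z
  proof (cases "z < n")
    case True
    then show ?thesis using that by (intro U(3)) (simp add: ys_def)
  next
    case False
    have "D (e(z := a)) = D e" for e a
      using n False unfolding D_def by (auto intro!: arg_cong2[of _ _ _ _ dist] ev_cong)
    then have "down_closed z D" unfolding down_closed_def by (metis imp_self)
    then show ?thesis using U(3) by blast
  qed
  have closedV: "down_closed z V" for z
    using closedU bounded_all_closed_other[OF U(1) V] bounded_all_closed[OF V(2)] by (cases "z = x") auto
  define C' where "C' e = both (C e) (V e)" for e
  have term_funC': "term_fun C'" unfolding C'_def by (intro term_fun_intros C V) simp_all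
  have closedC': "down_closed z C'" for z
    using C(2)[of z] closedV[of z] unfolding down_closed_def C'_def by (blast intro: both_mono)
  have "imp (C' e) (D e) zr" for e
    unfolding C'_def using imp_cut bothD2 VU U(2) by blast
  then have stepC': "imp (C' e) (D (e(x := sc (e x)))) zr" for e
    unfolding D_def imp_dist_iff by (intro step term_funC' closedC') (auto simp: C'_def bothD1)
  have CV: "cnd (C (e(x := a))) (V (e(x := a))) zr = zr" for e a
  proof (rule imp_induct[where T = "\<lambda>a. cnd (C (e(x := a))) (V (e(x := a))) zr"])
    show "poly_fun (\<lambda>e'. cnd (C (e(x := e' 0))) (V (e(x := e' 0))) zr)"
      by (auto intro!: poly_fun_intros poly_fun_term_fun_upd[OF C(1)] poly_fun_term_fun_upd[OF V(1)])
    \<comment> \<open>at \<open>x = 0\<close>, the left premise of \<open>(case)\<close> holds unconditionally, hence for all other variables\<close>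
    have "\<forall>e\<in>{e. e x = zr}. imp zr (U e) zr"
    proof (rule U(4))
      show "\<forall>e\<in>{e. e x = zr}. imp zr (D e) zr"
        using base by (auto simp: D_def) (metis dist_self fun_upd_triv)
    qed (auto simp: ys_def intro!: poly_fun_intros)
    then show "cnd (C (e(x := zr))) (V (e(x := zr))) zr = zr"
      using V(2) by (simp add: bounded_all_def)
    show "imp (cnd (C (e(x := a))) (V (e(x := a))) zr)
        (cnd (C (e(x := sc a))) (V (e(x := sc a))) zr) zr" for a
    proof (rule imp_cndI)
      let ?h = "both (cnd (C (e(x := a))) (V (e(x := a))) zr) (C (e(x := sc a)))"
      \<comment> \<open>\<open>C\<close> at the successor of \<open>a\<close> and \<open>V\<close> at \<open>a\<close>, as a condition on the other variables only\<close>
      define P where "P e' = both (C e') (V (e'(x := a)))" for e'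
      have CC: "imp (C (e(x := sc a))) (C (e(x := a))) zr" for e
        using C(2) by (simp add: down_closed_def)
      have hV: "imp ?h (V (e(x := a))) zr"
        by (rule imp_cndD[OF bothD1 imp_cut[OF bothD2 CC]])
      have "\<forall>e\<in>{e. e x = sc a}. imp (P e) (U e) zr"
      proof (rule U(4))
        show "\<forall>e. \<forall>y\<in>set ys. poly_fun (\<lambda>e'. P (e(y := e' 0)))"
          unfolding P_def
          by (auto intro!: poly_fun_intros poly_fun_term_fun_upd[OF C(1)] poly_fun_term_fun[OF V(1)] poly_fun_upd simp del: fun_upd_apply)
        show "\<forall>e\<in>{e. e x = sc a}. \<forall>y\<in>set ys. \<forall>b. imp (P (e(y := sc b))) (P (e(y := b))) zr"
          using C(2) closedV unfolding P_def ys_def down_closed_def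
          by (auto intro!: both_mono simp: fun_upd_twist[where c = x])
        show "\<forall>e\<in>{e. e x = sc a}. imp (P e) (D e) zr"
        proof clarify
          fix e :: env assume "e x = sc a"
          then have e: "e(x := sc a) = e" by (metis fun_upd_triv)
          have "imp (P e) (C' (e(x := a))) zr"
            unfolding P_def C'_def using CC[of e] by (intro both_mono imp_self) (simp add: e)
          then show "imp (P e) (D e) zr"
            using stepC'[of "e(x := a)"] by (auto simp: e intro: imp_cut)
        qed
      qed (auto simp: ys_def)
      then have "imp (P (e(x := sc a))) (U (e(x := sc a))) zr" by simp
      moreover have "imp ?h (P (e(x := sc a))) zr"
        unfolding P_def using hV by (intro bothI bothD2) simp
      ultimately have "imp ?h (U (e(x := sc a))) zr" using imp_cut by blast
      then show "imp ?h (V (e(x := sc a))) zr"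
        using V(2) hV bothI by (simp add: bounded_all_def)
    qed
  qed
  from CV[of e "e x"] have "imp (C e) (V e) zr" by (simp add: imp_def)
  then have "imp (C e) (D e) zr" using imp_cut VU U(2) by blast
  then show ?thesis by (simp add: D_def imp_dist_iff)
qed

lemma wf_of_subst: "wf_trm (subst x Q F) \<Longrightarrow> occ x F \<noteq> 0 \<Longrightarrow> wf_trm Q"
  by (induction F) (auto split: if_splits)

lemma unfolds_sound:
  assumes "unfolds P Q" "occ x F = 1" "wf_trm (subst x P F)" "wf_trm (subst x Q F)"
  shows "ev e (subst x P F) = ev e (subst x Q F)"
proof -
  have wf: "wf_trm P" "wf_trm Q" using wf_of_subst assms by (metis zero_neq_one)+
  have "ev e P = ev e Q"
    using assms(1) wf
  proof (cases rule: unfolds.cases)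
    case (2 k n Bs)
    then show ?thesis by simp
  next
    case (3 g fs Bs)
    then show ?thesis
      using wf by (auto simp: comp_def elim!: PR.cases[of _ "Comp g fs"] intro!: ap_Comp[THEN trans])
  next
    case (4 g h Bs)
    then have "PR (length Bs) g" "PR (length Bs + 2) h"
      using wf by (auto elim: PR.cases)
    then show ?thesis using 4 ap_Rec_zero[of "map (ev e) Bs"] by simp
  next
    case (5 g h Bs E)
    then have "PR (length Bs) g" "PR (length Bs + 2) h"
      using wf by (auto elim: PR.cases)
    then show ?thesis using 5 ap_Rec_succ[of "map (ev e) Bs"] by simp
  qed simp
  then show ?thesis by (simp add: ev_subst)
qed

text \<open>
  Premises that inherit no hypotheses, those of \<open>(sub)\<close> and the left ones of \<open>(case)\<close>, are used with the
  condition \<open>0 = 0\<close>; their equations hold in every environment, so that variables may be substituted.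
\<close>
lemma cyc_sound:
  assumes "cyc \<Gamma> E" "term_fun C" "\<And>z. down_closed z C"
    and "\<And>A B e. (A \<approx> B) \<in> \<Gamma> \<Longrightarrow> imp (C e) (ev e A) (ev e B)"
  shows "imp (C e) (ev e (lhs E)) (ev e (rhs E))"
  using assms
proof (induction arbitrary: C e rule: cyc.induct)
  case (cyc_init E \<Gamma>)
  then show ?case by (auto simp: initial_def)
next
  case (cyc_back E \<Gamma>)
  then show ?case by (metis eqn.collapse)
next
  case (cyc_step E r es \<Gamma>)
  have wf: "wf_trm (lhs E)" "wf_trm (rhs E)" using cyc_step.hyps(1) by (auto simp: wf_eqn_def)
  have wfs: "wf_trm (lhs E')" "wf_trm (rhs E')" if "E' \<in> set es" for E'
    using cyc_step.hyps(4) cyc_wf that by (metis in_set_conv_nth wf_eqn_def)+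
  have theorem_at: "ev e (lhs (es ! i)) = ev e (rhs (es ! i))"
    if "i < length es" "inherit r i E \<Gamma> = {}" for i e
    using cyc_step.IH[OF that(1) term_fun_zr, of e] that(2) by (simp add: down_closed_def)
  have hyp_at: "imp (C e) (ev e (lhs (es ! i))) (ev e (rhs (es ! i)))"
    if "i < length es" "inherit r i E \<Gamma> = \<Gamma>" for i e
    using cyc_step.IH[OF that(1) cyc_step.prems(1,2)] cyc_step.prems(3) that(2) by simp
  from cyc_step.hyps(3) show ?case
  proof (cases rule: infer.cases)
    case (fun_left P Q x F A)
    then show ?thesis
      using hyp_at[of 0 e] unfolds_sound[of P Q x F e] wf wfs by (simp add: inherit_def)
  next
    case (fun_right P Q x F A)
    then show ?thesis
      using hyp_at[of 0 e] unfolds_sound[of P Q x F e] wf wfs by (simp add: inherit_def)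
  next
    case (sub G H x A)
    then show ?thesis
      using theorem_at[of 0 "e(x := ev e A)"] by (simp add: inherit_def ev_subst)
  next
    case (rep A B x G)
    then have "wf_trm G" using wf wf_subst_imp_wf by auto
    then have "term_fun (\<lambda>e. ev e G)" by (rule term_fun_ev)
    then have "poly_fun (\<lambda>e'. ev (e(x := e' 0)) G)" by (rule poly_fun_term_fun_upd)
    moreover have "imp (C e) (ev e A) (ev e B)" using hyp_at[of 0 e] rep by (simp add: inherit_def)
    ultimately have "imp (C e) (ev (e(x := ev e A)) G) (ev (e(x := ev e B)) G)" by (rule imp_cong)
    then show ?thesis using rep by (simp add: ev_subst)
  next
    case (tran A B D)
    then show ?thesis
      using hyp_at[of 0 e] hyp_at[of 1 e] imp_trans by (fastforce simp: inherit_def)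
  next
    case (case_rule x G H)
    have "imp (C e) (ev e G) (ev e H)"
    proof (rule case_sound[of C G H x e])
      show "ev (e(x := zr)) G = ev (e(x := zr)) H" for e
        using theorem_at[of 0 e] case_rule by (simp add: inherit_def ev_subst)
      fix C' e
      assume C': "term_fun C'" "\<And>z. down_closed z C'" "\<And>e. imp (C' e) (C e) zr"
        "\<And>e. imp (C' e) (ev e G) (ev e H)"
      have "imp (C' e) (ev e A) (ev e B)" if "(A \<approx> B) \<in> inherit r 1 E \<Gamma>" for A B e
      proof (cases "(A \<approx> B) = E")
        case True
        then show ?thesis using C'(4) case_rule by simp
      next
        case False
        then have "(A \<approx> B) \<in> \<Gamma>" using that case_rule by (auto simp: inherit_def)
        then show ?thesis using cyc_step.prems(3) C'(3) imp_cut by blast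
      qed
      moreover have "1 < length es" using case_rule by simp
      ultimately have "imp (C' e) (ev e (lhs (es ! 1))) (ev e (rhs (es ! 1)))"
        using cyc_step.IH C'(1,2) by blast
      then show
        "imp (C' e) (ev (e(x := sc (e x))) G) (ev (e(x := sc (e x))) H)"
        using case_rule by (simp add: ev_subst)
    qed (use cyc_step.prems wf case_rule in auto)
    then show ?thesis using case_rule by simp
  next
    case ind
    then show ?thesis using cyc_step.hyps(2) by simp
  qed
qed

lemma cyc_imp_pra:
  assumes "cyc {} (A \<approx> B)"
  shows "pra (A \<approx> B)"
proof -
  have "imp zr (ev var A) (ev var B)"
    using cyc_sound[OF assms term_fun_zr, of var] by (simp add: down_closed_def)
  moreover have "wf_trm A" "wf_trm B" using cyc_wf[OF assms] by (auto simp: wf_eqn_def)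
  ultimately show ?thesis by (simp add: ev_var cls_eq_iff)
qed

theorem theorem2:
  fixes A B :: trm
  assumes "wf_trm A" and "wf_trm B"
  shows "pra_provable (A \<approx> B) \<longleftrightarrow> cpra_provable (A \<approx> B)"
  using pra_imp_cyc cyc_imp_pra by (auto simp: pra_provable_iff cpra_provable_iff)

end
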